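(* Let $q\in\mathbb{N}^+$ and let $(G_n)_{n\ge0}$ be a sequence of finite $(q+1)$-regular graphs. For each $n$ let $\mathcal G_n$ be a subgroup of $U(N_n)$. Then $\mu(G_n)$ converges weakly to the Kesten–McKay distribution $\mu_q$ if and only if $\mu(G_n,\sigma_n)$ converges weakly to $\mu_q$ for every choice of $\mathcal G_n$-colors $(\sigma_n)_{n\ge0}$.
   Context: Graphs may have multi-edges and loops; each edge gives two mutually inverse directed edges $e,\overline e$ in $\vec E$, with origin $o(e)$ and terminus $t(e)$; the adjacency matrix has $A_{ab}=\#\{e\in\vec E:o(e)=a,t(e)=b\}$, and $(q+1)$-regular means every vertex is the origin of $q+1$ directed edges. A $\mathcal G$-color ($\mathcal G\le U(N)$) is a map $\sigma:\vec E\to\mathcal G$ with $\sigma(\overline e)=\sigma(e)^{-1}$; $A^\sigma$ is the $N|V|\times N|V|$ self-adjoint block matrix with blocks $(A^\sigma)_{ij}=\sum_{e: o(e)=i,t(e)=j}\sigma(e)$. Normalized spectral measures: $\mu(G)=\frac{1}{|V|}\sum_k\delta_{q^{-1/2}\lambda_k(A)}$ and $\mu(G,\sigma)=\frac{1}{N|V|}\sum_{k=1}^{N|V|}\delta_{q^{-1/2}\lambda_k(A^\sigma)}$, where $\lambda_k(\cdot)$ are eigenvalues. Kesten–McKay distribution: $d\mu_q(x)=\frac{1}{2\pi}\frac{(q+1)\sqrt{4-x^2}}{(q^{-1/2}+q^{1/2})^2-x^2}\mathbf 1_{|x|\le2}dx$. *)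

theory Defs
  imports "HOL-Probability.Probability" "Jordan_Normal_Form.Schur_Decomposition"
begin

text \<open>A finite graph (multi-edges and loops allowed), given by its directed edges.
  Vertices are 0,...,nV-1 and directed edges are 0,...,nE-1; every undirected edge
  contributes two mutually inverse directed edges e and rev e.\<close>

record graph =
  nV :: nat
  nE :: nat
  org :: "nat \<Rightarrow> nat"
  ter :: "nat \<Rightarrow> nat"
  rev :: "nat \<Rightarrow> nat"

definition wf_graph :: "graph \<Rightarrow> bool" where
  "wf_graph G \<longleftrightarrow> 0 < nV G \<and>
     (\<forall>e < nE G. org G e < nV G \<and> ter G e < nV G \<and> rev G e < nE G \<and>
        rev G (rev G e) = e \<and> rev G e \<noteq> e \<and> org G (rev G e) = ter G e)"

definition regular_graph :: "nat \<Rightarrow> graph \<Rightarrow> bool" where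
  "regular_graph d G \<longleftrightarrow> wf_graph G \<and>
     (\<forall>a < nV G. card {e. e < nE G \<and> org G e = a} = d)"

definition adj_mat :: "graph \<Rightarrow> complex mat" where
  "adj_mat G = mat (nV G) (nV G)
     (\<lambda>(a, b). of_nat (card {e. e < nE G \<and> org G e = a \<and> ter G e = b}))"

definition unitary_mat :: "nat \<Rightarrow> complex mat \<Rightarrow> bool" where
  "unitary_mat N U \<longleftrightarrow> U \<in> carrier_mat N N \<and> U * mat_adjoint U = 1\<^sub>m N
     \<and> mat_adjoint U * U = 1\<^sub>m N"

definition subgroup_U :: "nat \<Rightarrow> complex mat set \<Rightarrow> bool" where
  "subgroup_U N Gs \<longleftrightarrow> (\<forall>U\<in>Gs. unitary_mat N U) \<and> 1\<^sub>m N \<in> Gs \<and>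
     (\<forall>U\<in>Gs. \<forall>V\<in>Gs. U * V \<in> Gs) \<and> (\<forall>U\<in>Gs. mat_adjoint U \<in> Gs)"

definition is_color :: "graph \<Rightarrow> nat \<Rightarrow> complex mat set \<Rightarrow> (nat \<Rightarrow> complex mat) \<Rightarrow> bool" where
  "is_color G N Gs \<sigma> \<longleftrightarrow> (\<forall>e < nE G. \<sigma> e \<in> Gs \<and> \<sigma> (rev G e) * \<sigma> e = 1\<^sub>m N)"

definition col_adj_mat :: "graph \<Rightarrow> nat \<Rightarrow> (nat \<Rightarrow> complex mat) \<Rightarrow> complex mat" where
  "col_adj_mat G N \<sigma> = mat (N * nV G) (N * nV G)
     (\<lambda>(a, b). \<Sum>e\<in>{e. e < nE G \<and> org G e = a div N \<and> ter G e = b div N}.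
                 \<sigma> e $$ (a mod N, b mod N))"

definition spec_measure :: "nat \<Rightarrow> complex mat \<Rightarrow> real measure" where
  "spec_measure q A = distr (measure_pmf (pmf_of_multiset
       (image_mset (\<lambda>z. Re z / sqrt (real q)) (proots (char_poly A))))) borel id"

definition mu_graph :: "nat \<Rightarrow> graph \<Rightarrow> real measure" where
  "mu_graph q G = spec_measure q (adj_mat G)"

definition mu_col :: "nat \<Rightarrow> graph \<Rightarrow> nat \<Rightarrow> (nat \<Rightarrow> complex mat) \<Rightarrow> real measure" where
  "mu_col q G N \<sigma> = spec_measure q (col_adj_mat G N \<sigma>)"

definition kesten_mckay_density :: "nat \<Rightarrow> real \<Rightarrow> real" where
  "kesten_mckay_density q x =
     (if \<bar>x\<bar> \<le> 2 then
        (real q + 1) * sqrt (4 - x\<^sup>2) /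
          (2 * pi * ((1 / sqrt (real q) + sqrt (real q))\<^sup>2 - x\<^sup>2))
      else 0)"

definition kesten_mckay :: "nat \<Rightarrow> real measure" where
  "kesten_mckay q = density lborel (\<lambda>x. ennreal (kesten_mckay_density q x))"

end

theory Submission
  imports Defs
begin

text \<open>Let \<open>A\<^sub>r\<close> be the matrix that counts non-backtracking walks of length \<open>r\<close>, each weighted by the
  product of its colors. It is \<open>p\<^sub>r(A)\<close> for a polynomial \<open>p\<^sub>r\<close> that depends only on \<open>q\<close>, because
  regularity and \<open>\<sigma>(e) \<sigma>(rev e) = 1\<close> determine the backtracking term of \<open>A A\<^sub>r\<close>. The polynomials
  \<open>p\<^sub>r(\<surd>q x)\<close> with \<open>r \<ge> 1\<close> have Kesten--McKay integral \<open>0\<close>, and all spectra lie in a fixed compact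
  interval, so convergence to the Kesten--McKay distribution means that the normalized trace of
  \<open>A\<^sub>r\<close> tends to \<open>0\<close> for every \<open>r \<ge> 1\<close>. A sum of \<open>k\<close> unitary matrices of size \<open>N\<close> has trace at most
  \<open>k N\<close> in modulus, so the colored normalized traces are bounded by the uncolored ones; the
  trivial color attains equality.\<close>

text \<open>Powers of \<open>A\<close> would not serve. Their colored traces are dominated by the
  uncolored ones as well, but domination forces convergence only towards 0, and some Kesten--McKay
  moments are not 0. The polynomials strip off the backtracking with coefficients that do not depend
  on the color, which moves every limit of positive index to 0. The value 0 reflects the infinite
  regular tree, where no non-backtracking walk of positive length is closed. The coefficient is
  \<open>q + 1\<close> for \<open>r = 0\<close> because each of the \<open>q + 1\<close> edges at a
  vertex can be traversed and reversed at once. For longer walks the edge that starts the remaining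
  walk is excluded, which leaves \<open>q\<close>. On the analytic side the delicate case is
  \<open>q = 1\<close>: the denominator of the density vanishes at the ends of [-2, 2], and the
  contraction by \<open>1 / q\<close> that evaluates the integrals for \<open>q > 1\<close> is
  lost.\<close>

fun km_poly :: "nat \<Rightarrow> nat \<Rightarrow> 'a::comm_ring_1 \<Rightarrow> 'a" where
  "km_poly q 0 x = 1"
| "km_poly q (Suc 0) x = x"
| "km_poly q (Suc (Suc r)) x = x * km_poly q (Suc r) x - (if r = 0 then of_nat q + 1 else of_nat q) * km_poly q r x"

text \<open>\<open>km_poly\<close> is polymorphic because it is evaluated at complex eigenvalues and
  under real integrals; this identity links the two uses.\<close>

lemma of_real_km_poly: "of_real (km_poly q r x) = (km_poly q r (of_real x) :: 'a :: {real_algebra_1, comm_ring_1})"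
  by (induction q r x rule: km_poly.induct) auto

section \<open>Traces and eigenvalues\<close>

lemma sum_only_one:
  assumes "finite A" "i \<in> A" "\<And>k. k \<in> A \<Longrightarrow> k \<noteq> i \<Longrightarrow> f k = 0"
  shows "sum f A = (f i :: 'a::comm_monoid_add)"
  using assms by (subst sum.remove[of A i]) (auto intro!: sum.neutral)

lemma triangular_mult:
  fixes B Y :: "'a::comm_ring_1 mat"
  assumes B: "B \<in> carrier_mat n n" and Y: "Y \<in> carrier_mat n n"
    and uB: "upper_triangular B" and uY: "upper_triangular Y"
  shows "upper_triangular (B * Y)"
    and "i < n \<Longrightarrow> (B * Y) $$ (i, i) = B $$ (i, i) * Y $$ (i, i)"
proof -
  have e: "(B * Y) $$ (i, j) = (\<Sum>k<n. B $$ (i, k) * Y $$ (k, j))" if "i < n" "j < n" for i j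
    using B Y that by (auto simp: scalar_prod_def atLeast0LessThan intro!: sum.cong)
  have zB: "B $$ (i, j) = 0" if "j < i" "i < n" for i j
    using uB B that by (auto simp: upper_triangular_def)
  have zY: "Y $$ (i, j) = 0" if "j < i" "i < n" for i j
    using uY Y that by (auto simp: upper_triangular_def)
  show "upper_triangular (B * Y)"
  proof (rule upper_triangularI)
    fix i j assume "j < i" "i < dim_row (B * Y)"
    then have ij: "j < i" "i < n" using B by auto
    have "B $$ (i, k) * Y $$ (k, j) = 0" if "k < n" for k
      using zB[of k i] zY[of j k] ij that by (cases "k < i") auto
    then show "(B * Y) $$ (i, j) = 0"
      using e[of i j] ij by auto
  qed
  show "(B * Y) $$ (i, i) = B $$ (i, i) * Y $$ (i, i)" if i: "i < n"
  proof -
    have "B $$ (i, k) * Y $$ (k, i) = 0" if "k \<in> {..<n}" "k \<noteq> i" for k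
      using zB[of k i] zY[of i k] i that by (cases "k < i") auto
    then show ?thesis using e[OF i i] i sum_only_one[of "{..<n}" i "\<lambda>k. B $$ (i, k) * Y $$ (k, i)"]
      by auto
  qed
qed

lemma sum_diag_mult_commute:
  fixes A B :: "'a::comm_ring_1 mat"
  assumes "A \<in> carrier_mat n n" "B \<in> carrier_mat n n"
  shows "(\<Sum>i<n. (A * B) $$ (i, i)) = (\<Sum>i<n. (B * A) $$ (i, i))"
proof -
  have "(\<Sum>i<n. (A * B) $$ (i, i)) = (\<Sum>i<n. \<Sum>k<n. A $$ (i, k) * B $$ (k, i))"
    using assms by (auto simp: scalar_prod_def atLeast0LessThan intro!: sum.cong)
  also have "\<dots> = (\<Sum>i<n. \<Sum>k<n. B $$ (i, k) * A $$ (k, i))"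
    by (subst sum.swap) (simp add: mult.commute)
  also have "\<dots> = (\<Sum>i<n. (B * A) $$ (i, i))"
    using assms by (auto simp: scalar_prod_def atLeast0LessThan intro!: sum.cong)
  finally show ?thesis .
qed

text \<open>The matrices \<open>X r\<close> are given by their recurrence only. In a Schur basis
  \<open>A\<close> becomes upper triangular, the recurrence preserves triangularity, and diagonals
  of upper triangular matrices multiply entrywise, so the diagonal obeys the scalar recurrence of
  \<open>km_poly\<close>.\<close>

lemma trace_km_poly:
  fixes A :: "complex mat" and X :: "nat \<Rightarrow> complex mat"
  assumes A: "A \<in> carrier_mat n n" and X: "\<And>r. X r \<in> carrier_mat n n"
    and X0: "X 0 = 1\<^sub>m n" and X1: "X (Suc 0) = A"
    and XS: "\<And>r. A * X (Suc r) = X (Suc (Suc r)) + (if r = 0 then of_nat q + 1 else of_nat q) \<cdot>\<^sub>m X r"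
  shows "(\<Sum>i<n. X r $$ (i, i)) = (\<Sum>z\<in>#proots (char_poly A). km_poly q r z)"
proof -
  obtain es where es: "char_poly A = (\<Prod>e\<leftarrow>es. [:- e, 1:])"
    using char_poly_factorized[OF A] by blast
  obtain B P Q where BPQ: "schur_decomposition A es = (B, P, Q)"
    by (cases "schur_decomposition A es")
  from schur_decomposition[OF A es this]
  have sim: "similar_mat_wit A B P Q" and uB: "upper_triangular B" and dB: "diag_mat B = es"
    by auto
  from similar_mat_witD2[OF A sim]
  have PQ: "P * Q = 1\<^sub>m n" and QP: "Q * P = 1\<^sub>m n" and AB: "A = P * B * Q"
    and B: "B \<in> carrier_mat n n" and P: "P \<in> carrier_mat n n" and Q: "Q \<in> carrier_mat n n"
    by auto
  have XP: "X r * P \<in> carrier_mat n n" for r using X P by (rule mult_carrier_mat)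
  define Y where "Y r = Q * (X r * P)" for r
  have Y: "Y r \<in> carrier_mat n n" for r
    unfolding Y_def using X P Q by auto
  have BQ: "Q * A = B * Q"
  proof -
    have "Q * A = Q * (P * (B * Q))" unfolding AB using P B Q by (metis assoc_mult_mat)
    also have "\<dots> = (Q * P) * (B * Q)" using P B Q by (intro assoc_mult_mat[symmetric, of _ n n _ n _ n]) auto
    finally show ?thesis using QP B Q by simp
  qed
  have Y0: "Y 0 = 1\<^sub>m n" unfolding Y_def X0 using P QP by simp
  have Y1: "Y (Suc 0) = B"
  proof -
    have "Y (Suc 0) = (Q * A) * P" unfolding Y_def X1 using P Q A by (metis assoc_mult_mat)
    also have "\<dots> = B * (Q * P)" unfolding BQ using P Q B by (metis assoc_mult_mat)
    finally show ?thesis using QP B by simp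
  qed
  have YS: "B * Y (Suc r) = Y (Suc (Suc r)) + (if r = 0 then of_nat q + 1 else of_nat q) \<cdot>\<^sub>m Y r" for r
  proof -
    let ?c = "(if r = 0 then of_nat q + 1 else of_nat q) :: complex"
    have "B * Y (Suc r) = (B * Q) * (X (Suc r) * P)"
      unfolding Y_def using P Q B XP by (intro assoc_mult_mat[symmetric, of _ n n _ n _ n]) auto
    also have "\<dots> = Q * (A * (X (Suc r) * P))"
      unfolding BQ[symmetric] using P Q A XP by (intro assoc_mult_mat[of _ n n _ n _ n]) auto
    also have "A * (X (Suc r) * P) = (A * X (Suc r)) * P"
      using P Q A X by (intro assoc_mult_mat[symmetric, of _ n n _ n _ n]) auto
    also have "\<dots> = X (Suc (Suc r)) * P + (?c \<cdot>\<^sub>m X r) * P"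
      unfolding XS using X P by (intro add_mult_distrib_mat[of _ n n _ _ n]) auto
    also have "(?c \<cdot>\<^sub>m X r) * P = ?c \<cdot>\<^sub>m (X r * P)"
      using X P by (intro mult_smult_assoc_mat[of _ n n]) auto
    also have "Q * (X (Suc (Suc r)) * P + ?c \<cdot>\<^sub>m (X r * P)) = Y (Suc (Suc r)) + Q * (?c \<cdot>\<^sub>m (X r * P))"
      unfolding Y_def using XP Q by (intro mult_add_distrib_mat[of _ n n _ n]) auto
    also have "Q * (?c \<cdot>\<^sub>m (X r * P)) = ?c \<cdot>\<^sub>m Y r"
      unfolding Y_def using XP Q by (intro mult_smult_distrib[of _ n n _ n]) auto
    finally show ?thesis .
  qed
  have YS': "Y (Suc (Suc r)) $$ (i, j) = (B * Y (Suc r)) $$ (i, j)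
      - (if r = 0 then of_nat q + 1 else of_nat q) * Y r $$ (i, j)" if "i < n" "j < n" for r i j
    using arg_cong[OF YS, of "\<lambda>M. M $$ (i, j)"] Y[of r] Y[of "Suc (Suc r)"] that by auto
  have step: "upper_triangular (Y (Suc (Suc r))) \<and> (\<forall>i<n. Y (Suc (Suc r)) $$ (i, i) = km_poly q (Suc (Suc r)) (B $$ (i, i)))"
    if "upper_triangular (Y r) \<and> (\<forall>i<n. Y r $$ (i, i) = km_poly q r (B $$ (i, i)))"
      and "upper_triangular (Y (Suc r)) \<and> (\<forall>i<n. Y (Suc r) $$ (i, i) = km_poly q (Suc r) (B $$ (i, i)))" for r
  proof -
    have u: "upper_triangular (B * Y (Suc r))"
      and d: "\<And>i. i < n \<Longrightarrow> (B * Y (Suc r)) $$ (i, i) = B $$ (i, i) * Y (Suc r) $$ (i, i)"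
      using triangular_mult[OF B Y[of "Suc r"] uB] that(2) by auto
    have "upper_triangular (Y (Suc (Suc r)))"
    proof (rule upper_triangularI)
      fix i j assume "j < i" "i < dim_row (Y (Suc (Suc r)))"
      then have ij: "j < i" "i < n" "j < n" using Y[of "Suc (Suc r)"] by auto
      then have "(B * Y (Suc r)) $$ (i, j) = 0" "Y r $$ (i, j) = 0"
        using u that(1) B Y[of r] by (auto simp: upper_triangular_def)
      then show "Y (Suc (Suc r)) $$ (i, j) = 0" using YS'[of i j r] ij by auto
    qed
    moreover have "Y (Suc (Suc r)) $$ (i, i) = km_poly q (Suc (Suc r)) (B $$ (i, i))" if "i < n" for i
      using YS'[of i i r] d \<open>i < n\<close> \<open>upper_triangular (Y r) \<and> _\<close> \<open>upper_triangular (Y (Suc r)) \<and> _\<close> by simp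
    ultimately show ?thesis by blast
  qed
  \<comment> \<open>The recurrence has order two, so two consecutive indices are carried through the
    induction.\<close>
  have main: "(upper_triangular (Y r) \<and> (\<forall>i<n. Y r $$ (i, i) = km_poly q r (B $$ (i, i)))) \<and>
      (upper_triangular (Y (Suc r)) \<and> (\<forall>i<n. Y (Suc r) $$ (i, i) = km_poly q (Suc r) (B $$ (i, i))))" for r
  proof (induction r)
    case 0
    show ?case unfolding Y0 Y1 using uB by auto
  next
    case (Suc r)
    then show ?case using step[of r] by blast
  qed
  have "(\<Sum>i<n. X r $$ (i, i)) = (\<Sum>i<n. (X r * (P * Q)) $$ (i, i))"
    unfolding PQ using X[of r] by simp
  also have "X r * (P * Q) = (X r * P) * Q"
    using X P Q by (intro assoc_mult_mat[symmetric, of _ n n _ n _ n]) auto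
  also have "(\<Sum>i<n. ((X r * P) * Q) $$ (i, i)) = (\<Sum>i<n. Y r $$ (i, i))"
    unfolding Y_def using XP Q by (intro sum_diag_mult_commute) auto
  also have "\<dots> = (\<Sum>i<n. km_poly q r (B $$ (i, i)))" using main by auto
  also have "\<dots> = (\<Sum>z\<leftarrow>es. km_poly q r z)"
    unfolding dB[symmetric] diag_mat_def using B
    by (simp add: sum_list_sum_nth atLeast0LessThan)
  also have "\<dots> = (\<Sum>z\<in>#mset es. km_poly q r z)"
    by (metis mset_map sum_mset_sum_list)
  also have "mset es = proots (char_poly A)"
    unfolding es
  proof (induction es)
    case (Cons e es)
    have "(\<Prod>e\<leftarrow>es. [:- e, 1:]) \<noteq> 0" by (auto simp: prod_list_zero_iff)
    then show ?case using Cons by (simp add: proots_mult del: mult_pCons_left)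
  qed simp
  finally show ?thesis .
qed

lemma sum_count_eq_sum_mset:
  fixes f :: "'a \<Rightarrow> real"
  assumes "finite A" "set_mset M \<subseteq> A"
  shows "(\<Sum>a\<in>A. f a * count M a) = (\<Sum>z\<in>#M. f z)"
  using assms(2)
proof (induction M)
  case (add x M)
  have "(\<Sum>a\<in>A. f a * count (add_mset x M) a) = (\<Sum>a\<in>A. f a * count M a + (if a = x then f a else 0))"
    by (intro sum.cong) (auto simp: algebra_simps)
  also have "\<dots> = (\<Sum>a\<in>A. f a * count M a) + f x"
    using add.prems assms(1) by (simp add: sum.distrib)
  finally show ?case using add by simp
qed simp

lemma pmf_of_multiset_expectation:
  fixes f :: "'a \<Rightarrow> real"
  assumes "M \<noteq> {#}"
  shows "measure_pmf.expectation (pmf_of_multiset M) f = (\<Sum>z\<in>#M. f z) / size M"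
proof -
  have "measure_pmf.expectation (pmf_of_multiset M) f = (\<Sum>a\<in>set_mset M. f a * (count M a / size M))"
    using assms by (subst integral_measure_pmf_real[where A = "set_mset M"]) auto
  also have "\<dots> = (\<Sum>a\<in>set_mset M. f a * count M a) / size M"
    by (simp add: sum_divide_distrib)
  also have "(\<Sum>a\<in>set_mset M. f a * count M a) = (\<Sum>z\<in>#M. f z)"
    by (intro sum_count_eq_sum_mset) auto
  finally show ?thesis .
qed

section \<open>Colored non-backtracking walks\<close>

text \<open>Block indices are encoded as \<open>z = N * a + j\<close>, with vertex \<open>a\<close>
  and coordinate \<open>j\<close>. This turns a sum over matrix indices into a sum over vertices and
  coordinates.\<close>

lemma sum_div_mod:
  fixes g :: "nat \<Rightarrow> nat \<Rightarrow> 'a::comm_monoid_add"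
  assumes "N > 0"
  shows "(\<Sum>z<N * V. g (z div N) (z mod N)) = (\<Sum>a<V. \<Sum>j<N. g a j)"
proof -
  have "(\<Sum>a<V. \<Sum>j<N. g a j) = (\<Sum>(a, j)\<in>{..<V} \<times> {..<N}. g a j)"
    by (simp add: sum.cartesian_product)
  also have "\<dots> = (\<Sum>z<N * V. g (z div N) (z mod N))"
  proof (rule sum.reindex_bij_witness[where j = "\<lambda>(a, j). N * a + j" and i = "\<lambda>z. (z div N, z mod N)"])
    fix p assume "p \<in> {..<V} \<times> {..<N}"
    then obtain a j where p: "p = (a, j)" "a < V" "j < N" by auto
    have "N * a + j < N * Suc a" using p by simp
    also have "\<dots> \<le> N * V" using p by (intro mult_left_mono) auto
    finally show "(case p of (a, j) \<Rightarrow> N * a + j) \<in> {..<N * V}" using p by simp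
  qed (use assms in \<open>auto simp: less_mult_imp_div_less mult.commute\<close>)
  finally show ?thesis by simp
qed

lemma sum_swap3:
  "(\<Sum>i\<in>A. \<Sum>j\<in>B. \<Sum>k\<in>C. f i j k) = (\<Sum>j\<in>B. \<Sum>k\<in>C. \<Sum>i\<in>A. f i j k)"
  by (subst sum.swap, rule sum.cong[OF refl], rule sum.swap)

section \<open>Unitary matrices through their entries\<close>

lemma mat_mult_entry:
  assumes "U \<in> carrier_mat n n" "V \<in> carrier_mat n n" "i < n" "k < n"
  shows "(U * V) $$ (i, k) = (\<Sum>j<n. U $$ (i, j) * V $$ (j, k))"
  using assms by (auto simp: scalar_prod_def atLeast0LessThan intro!: sum.cong)

lemma mat_adjoint_carrier: "U \<in> carrier_mat n n \<Longrightarrow> mat_adjoint U \<in> carrier_mat n n"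
  using mat_of_rows_carrier(1)[of n "map conjugate (cols U)"] by (simp add: mat_adjoint_def)

lemma mat_adjoint_index:
  fixes U :: "complex mat"
  assumes "U \<in> carrier_mat n n" "i < n" "j < n"
  shows "mat_adjoint U $$ (i, j) = cnj (U $$ (j, i))"
  using assms by (simp add: mat_adjoint_def mat_of_rows_index)

lemma unitary_mat_rows:
  assumes U: "unitary_mat N U" and "i < N" "k < N"
  shows "(\<Sum>j<N. U $$ (i, j) * cnj (U $$ (k, j))) = (if i = k then 1 else 0)"
proof -
  have c: "U \<in> carrier_mat N N" and "U * mat_adjoint U = 1\<^sub>m N"
    using U by (auto simp: unitary_mat_def)
  then show ?thesis
    using mat_mult_entry[OF c mat_adjoint_carrier[OF c] assms(2,3)] assms(2,3)
    by (simp add: mat_adjoint_index[OF c])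
qed

text \<open>Orthonormal rows express only \<open>U * mat_adjoint U = 1\<close>; the other product
  follows because a one-sided inverse of a square matrix is two-sided.\<close>

lemma unitary_mat_iff:
  "unitary_mat N U \<longleftrightarrow> U \<in> carrier_mat N N \<and>
    (\<forall>i<N. \<forall>k<N. (\<Sum>j<N. U $$ (i, j) * cnj (U $$ (k, j))) = (if i = k then 1 else 0))"
proof
  assume "unitary_mat N U"
  then show "U \<in> carrier_mat N N \<and>
    (\<forall>i<N. \<forall>k<N. (\<Sum>j<N. U $$ (i, j) * cnj (U $$ (k, j))) = (if i = k then 1 else 0))"
    using unitary_mat_rows by (auto simp: unitary_mat_def)
next
  assume r: "U \<in> carrier_mat N N \<and>
    (\<forall>i<N. \<forall>k<N. (\<Sum>j<N. U $$ (i, j) * cnj (U $$ (k, j))) = (if i = k then 1 else 0))"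
  then have c: "U \<in> carrier_mat N N" by simp
  have "U * mat_adjoint U = 1\<^sub>m N"
  proof (rule eq_matI)
    fix i k assume "i < dim_row (1\<^sub>m N :: complex mat)" "k < dim_col (1\<^sub>m N :: complex mat)"
    then have ik: "i < N" "k < N" by auto
    then show "(U * mat_adjoint U) $$ (i, k) = 1\<^sub>m N $$ (i, k)"
      using r mat_mult_entry[OF c mat_adjoint_carrier[OF c] ik] by (auto simp: mat_adjoint_index[OF c])
  qed (use c mat_adjoint_carrier[OF c] in auto)
  then show "unitary_mat N U"
    using c mat_mult_left_right_inverse[OF c mat_adjoint_carrier[OF c]] by (simp add: unitary_mat_def)
qed

lemma unitary_mat_mult:
  assumes U: "unitary_mat N U" and V: "unitary_mat N V"
  shows "unitary_mat N (U * V)"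
proof -
  have c: "U \<in> carrier_mat N N" "V \<in> carrier_mat N N" using U V by (auto simp: unitary_mat_def)
  have "(\<Sum>j<N. (U * V) $$ (i, j) * cnj ((U * V) $$ (k, j))) = (if i = k then 1 else 0)"
    if ik: "i < N" "k < N" for i k
  proof -
    have "(\<Sum>j<N. (U * V) $$ (i, j) * cnj ((U * V) $$ (k, j)))
      = (\<Sum>j<N. (\<Sum>l<N. U $$ (i, l) * V $$ (l, j)) * cnj (\<Sum>m<N. U $$ (k, m) * V $$ (m, j)))"
      using c ik by (intro sum.cong) (auto simp: mat_mult_entry simp del: index_mult_mat)
    also have "\<dots> = (\<Sum>j<N. \<Sum>l<N. \<Sum>m<N. U $$ (i, l) * cnj (U $$ (k, m)) * (V $$ (l, j) * cnj (V $$ (m, j))))"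
      by (simp only: cnj_sum complex_cnj_mult sum_product mult_ac)
    also have "\<dots> = (\<Sum>l<N. \<Sum>m<N. \<Sum>j<N. U $$ (i, l) * cnj (U $$ (k, m)) * (V $$ (l, j) * cnj (V $$ (m, j))))"
      by (rule sum_swap3)
    also have "\<dots> = (\<Sum>l<N. \<Sum>m<N. U $$ (i, l) * cnj (U $$ (k, m)) * (if l = m then 1 else 0))"
      using unitary_mat_rows[OF V] by (intro sum.cong refl) (simp add: sum_distrib_left[symmetric])
    also have "\<dots> = (\<Sum>l<N. U $$ (i, l) * cnj (U $$ (k, l)))"
      by (intro sum.cong refl) (simp add: if_distrib cong: if_cong)
    also have "\<dots> = (if i = k then 1 else 0)" using unitary_mat_rows[OF U] ik by blast
    finally show ?thesis .
  qed
  then show ?thesis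
    unfolding unitary_mat_iff by (intro conjI allI impI mult_carrier_mat[OF c])
qed

lemma unitary_mat_one: "unitary_mat N (1\<^sub>m N)"
  unfolding unitary_mat_iff
proof (intro conjI allI impI)
  fix i k assume "i < N" "k < N"
  then have "(\<Sum>j<N. 1\<^sub>m N $$ (i, j) * cnj (1\<^sub>m N $$ (k, j))) = (\<Sum>j<N. if j = i then (if i = k then 1 else 0) else 0 :: complex)"
    by (intro sum.cong refl) auto
  then show "(\<Sum>j<N. 1\<^sub>m N $$ (i, j) * cnj (1\<^sub>m N $$ (k, j))) = (if i = k then 1 else 0 :: complex)"
    using \<open>i < N\<close> by simp
qed simp

text \<open>Each row has Euclidean norm 1. This is the source of the trace bound for sums of unitary
  matrices.\<close>

lemma unitary_mat_entry_le:
  assumes U: "unitary_mat N U" and "i < N" "j < N"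
  shows "cmod (U $$ (i, j)) \<le> 1"
proof -
  have "complex_of_real (\<Sum>j<N. (cmod (U $$ (i, j)))\<^sup>2) = 1"
    using unitary_mat_rows[OF U assms(2) assms(2)] by (simp only: of_real_sum complex_norm_square if_True simp_thms)
  then have s: "(\<Sum>j<N. (cmod (U $$ (i, j)))\<^sup>2) = 1" by (simp only: of_real_eq_1_iff)
  have "(cmod (U $$ (i, j)))\<^sup>2 \<le> (\<Sum>j<N. (cmod (U $$ (i, j)))\<^sup>2)"
    using assms by (intro member_le_sum) auto
  then have "(cmod (U $$ (i, j)))\<^sup>2 \<le> 1\<^sup>2" using s by simp
  then show ?thesis by (rule power2_le_imp_le) simp
qed

section \<open>Walk counts, walk matrices and their recurrence\<close>

definition out_edges :: "graph \<Rightarrow> nat \<Rightarrow> nat set" where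
  "out_edges G a = {e. e < nE G \<and> org G e = a}"

lemma finite_out_edges [simp]: "finite (out_edges G a)"
  unfolding out_edges_def by simp

text \<open>\<open>nbt G r e b\<close> counts the non-backtracking walks of length \<open>r + 1\<close> with first edge
  \<open>e\<close> and last vertex \<open>b\<close>; \<open>nbw G N \<sigma> r e i c\<close> is the entry \<open>(i, c mod N)\<close> of the sum
  of the colors of these walks, where \<open>b = c div N\<close>.\<close>

fun nbt :: "graph \<Rightarrow> nat \<Rightarrow> nat \<Rightarrow> nat \<Rightarrow> nat" where
  "nbt G 0 e b = (if ter G e = b then 1 else 0)"
| "nbt G (Suc r) e b = (\<Sum>f\<in>out_edges G (ter G e) - {rev G e}. nbt G r f b)"

fun nbw :: "graph \<Rightarrow> nat \<Rightarrow> (nat \<Rightarrow> complex mat) \<Rightarrow> nat \<Rightarrow> nat \<Rightarrow> nat \<Rightarrow> nat \<Rightarrow> complex" where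
  "nbw G N \<sigma> 0 e i c = (if ter G e = c div N then \<sigma> e $$ (i, c mod N) else 0)"
| "nbw G N \<sigma> (Suc r) e i c = (\<Sum>j<N. \<sigma> e $$ (i, j) * (\<Sum>f\<in>out_edges G (ter G e) - {rev G e}. nbw G N \<sigma> r f j c))"

text \<open>The index of \<open>nbw\<close> is one less than the length of the walk, hence the
  shift: \<open>nbm\<close> at \<open>r\<close> belongs to walks with exactly \<open>r\<close>
  edges.\<close>

fun nbm :: "graph \<Rightarrow> nat \<Rightarrow> (nat \<Rightarrow> complex mat) \<Rightarrow> nat \<Rightarrow> complex mat" where
  "nbm G N \<sigma> 0 = 1\<^sub>m (N * nV G)"
| "nbm G N \<sigma> (Suc r) = mat (N * nV G) (N * nV G)
     (\<lambda>(x, c). \<Sum>f\<in>out_edges G (x div N). nbw G N \<sigma> r f (x mod N) c)"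

text \<open>Walks of length \<open>r + 1\<close> that return to their starting vertex. Only
  consecutive edges are restricted: the last edge may be the inverse of the first one.\<close>

definition closed_nbt :: "graph \<Rightarrow> nat \<Rightarrow> nat" where
  "closed_nbt G r = (\<Sum>a<nV G. \<Sum>f\<in>out_edges G a. nbt G r f a)"

text \<open>Unitarity is asked of each color instead of membership in a fixed group, so that the
  trivial color of any size, and through size 1 the uncolored graph, is an instance too.\<close>

locale colored_graph =
  fixes G :: graph and q N :: nat and \<sigma> :: "nat \<Rightarrow> complex mat"
  assumes reg: "regular_graph (q + 1) G" and N_pos: "N > 0"
    and unitary: "\<And>e. e < nE G \<Longrightarrow> unitary_mat N (\<sigma> e)"
    and color_rev_mult: "\<And>e. e < nE G \<Longrightarrow> \<sigma> (rev G e) * \<sigma> e = 1\<^sub>m N"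
begin

lemma edge:
  assumes "e < nE G"
  shows "org G e < nV G" "ter G e < nV G" "rev G e < nE G" "rev G (rev G e) = e"
    "org G (rev G e) = ter G e" "ter G (rev G e) = org G e"
proof -
  have wf: "wf_graph G" using reg by (simp add: regular_graph_def)
  then show 1: "org G e < nV G" "ter G e < nV G" "rev G e < nE G" "rev G (rev G e) = e" "org G (rev G e) = ter G e"
    using assms by (auto simp: wf_graph_def)
  show "ter G (rev G e) = org G e"
    using wf 1(3,4) by (metis wf_graph_def)
qed

lemma card_out_edges: "a < nV G \<Longrightarrow> card (out_edges G a) = q + 1"
  using reg by (simp add: regular_graph_def out_edges_def)

lemma color_carrier: "e < nE G \<Longrightarrow> \<sigma> e \<in> carrier_mat N N"
  using unitary by (simp add: unitary_mat_def)

text \<open>The color of \<open>rev G e\<close> is a left inverse of a unitary matrix and therefore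
  its adjoint.\<close>

lemma color_rev:
  assumes "e < nE G" "i < N" "j < N"
  shows "\<sigma> (rev G e) $$ (i, j) = cnj (\<sigma> e $$ (j, i))"
proof -
  have c: "\<sigma> e \<in> carrier_mat N N" "\<sigma> (rev G e) \<in> carrier_mat N N"
    using assms edge color_carrier by auto
  note ca = mat_adjoint_carrier[OF c(1)]
  have "\<sigma> (rev G e) = \<sigma> (rev G e) * (\<sigma> e * mat_adjoint (\<sigma> e))"
    using unitary[OF assms(1)] c by (simp add: unitary_mat_def)
  also have "\<dots> = (\<sigma> (rev G e) * \<sigma> e) * mat_adjoint (\<sigma> e)"
    using c ca by (intro assoc_mult_mat[symmetric]) auto
  also have "\<dots> = mat_adjoint (\<sigma> e)"
    using color_rev_mult[OF assms(1)] ca by simp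
  finally show ?thesis using mat_adjoint_index[OF c(1) assms(2,3)] by simp
qed

lemma color_mult_rev:
  assumes "e < nE G" "i < N" "k < N"
  shows "(\<Sum>j<N. \<sigma> e $$ (i, j) * \<sigma> (rev G e) $$ (j, k)) = (if i = k then 1 else 0)"
  using unitary_mat_rows[OF unitary[OF assms(1)] assms(2,3)] color_rev[OF assms(1)] assms(3) by simp

lemma sum_edges_rev: "(\<Sum>e<nE G. f (rev G e)) = (\<Sum>e<nE G. f e)"
  by (rule sum.reindex_bij_witness[where i = "rev G" and j = "rev G"]) (auto simp: edge)

lemma sum_edges_org: "(\<Sum>a<nV G. \<Sum>e\<in>out_edges G a. f a e) = (\<Sum>e<nE G. f (org G e) e)"
proof -
  have "(\<Sum>e<nE G. f (org G e) e) = (\<Sum>a<nV G. sum (\<lambda>e. f (org G e) e) {e\<in>{..<nE G}. org G e = a})"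
    by (rule sum.group[symmetric]) (auto simp: edge)
  also have "\<dots> = (\<Sum>a<nV G. \<Sum>e\<in>out_edges G a. f a e)"
    by (intro sum.cong) (auto simp: out_edges_def)
  finally show ?thesis by simp
qed

text \<open>Unfolds the block structure once for two uses: with \<open>h\<close> a column of a walk
  matrix in the recurrence, and with \<open>h\<close> an eigenvector in the spectral bound.\<close>

lemma col_adj_mat_sum:
  assumes "x < N * nV G"
  shows "(\<Sum>z<N * nV G. col_adj_mat G N \<sigma> $$ (x, z) * h z) =
    (\<Sum>e\<in>out_edges G (x div N). \<Sum>j<N. \<sigma> e $$ (x mod N, j) * h (N * ter G e + j))"
proof -
  let ?O = "out_edges G (x div N)"
  have "(\<Sum>z<N * nV G. col_adj_mat G N \<sigma> $$ (x, z) * h z) =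
    (\<Sum>z<N * nV G. (\<lambda>b j. \<Sum>e\<in>?O. if ter G e = b then \<sigma> e $$ (x mod N, j) * h (N * b + j) else 0) (z div N) (z mod N))"
  proof (rule sum.cong[OF refl])
    fix z assume "z \<in> {..<N * nV G}"
    then have "col_adj_mat G N \<sigma> $$ (x, z) * h z =
      (\<Sum>e\<in>{e\<in>?O. ter G e = z div N}. \<sigma> e $$ (x mod N, z mod N) * h z)"
      using assms by (simp add: col_adj_mat_def sum_distrib_right out_edges_def conj_assoc)
    also have "\<dots> = (\<Sum>e\<in>?O. if ter G e = z div N then \<sigma> e $$ (x mod N, z mod N) * h z else 0)"
      by (subst sum.inter_filter) auto
    finally show "col_adj_mat G N \<sigma> $$ (x, z) * h z =
      (\<lambda>b j. \<Sum>e\<in>?O. if ter G e = b then \<sigma> e $$ (x mod N, j) * h (N * b + j) else 0) (z div N) (z mod N)"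
      by (simp only: mult_div_mod_eq)
  qed
  also have "\<dots> = (\<Sum>b<nV G. \<Sum>j<N. \<Sum>e\<in>?O. if ter G e = b then \<sigma> e $$ (x mod N, j) * h (N * b + j) else 0)"
    by (rule sum_div_mod[OF N_pos])
  also have "\<dots> = (\<Sum>b<nV G. \<Sum>e\<in>?O. \<Sum>j<N. if ter G e = b then \<sigma> e $$ (x mod N, j) * h (N * b + j) else 0)"
    by (intro sum.cong refl sum.swap)
  also have "\<dots> = (\<Sum>e\<in>?O. \<Sum>b<nV G. \<Sum>j<N. if ter G e = b then \<sigma> e $$ (x mod N, j) * h (N * b + j) else 0)"
    by (rule sum.swap)
  also have "\<dots> = (\<Sum>e\<in>?O. \<Sum>b<nV G. if b = ter G e then \<Sum>j<N. \<sigma> e $$ (x mod N, j) * h (N * b + j) else 0)"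
    by (intro sum.cong refl) auto
  also have "\<dots> = (\<Sum>e\<in>?O. \<Sum>j<N. \<sigma> e $$ (x mod N, j) * h (N * ter G e + j))"
    by (rule sum.cong[OF refl]) (simp add: out_edges_def edge)
  finally show ?thesis .
qed

lemma nbm_carrier: "nbm G N \<sigma> r \<in> carrier_mat (N * nV G) (N * nV G)"
  by (cases r) auto

lemma col_adj_mat_carrier: "col_adj_mat G N \<sigma> \<in> carrier_mat (N * nV G) (N * nV G)"
  by (simp add: col_adj_mat_def)

lemma nbm_1: "nbm G N \<sigma> (Suc 0) = col_adj_mat G N \<sigma>"
proof (rule eq_matI)
  fix x c assume "x < dim_row (col_adj_mat G N \<sigma>)" "c < dim_col (col_adj_mat G N \<sigma>)"
  then have xc: "x < N * nV G" "c < N * nV G" by (auto simp: col_adj_mat_def)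
  have "nbm G N \<sigma> (Suc 0) $$ (x, c) = (\<Sum>e\<in>out_edges G (x div N). if ter G e = c div N then \<sigma> e $$ (x mod N, c mod N) else 0)"
    using xc by simp
  also have "\<dots> = (\<Sum>e\<in>{e\<in>out_edges G (x div N). ter G e = c div N}. \<sigma> e $$ (x mod N, c mod N))"
    by (subst sum.inter_filter) auto
  also have "\<dots> = col_adj_mat G N \<sigma> $$ (x, c)"
    using xc by (simp add: col_adj_mat_def out_edges_def conj_assoc)
  finally show "nbm G N \<sigma> (Suc 0) $$ (x, c) = col_adj_mat G N \<sigma> $$ (x, c)" .
qed (auto simp: col_adj_mat_def)

text \<open>Traversing \<open>e\<close> and then its inverse cancels the colors and returns to the
  origin of \<open>e\<close>, which leaves an entry of the identity matrix.\<close>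

lemma backtrack_0:
  assumes "e < nE G" "i < N"
  shows "(\<Sum>j<N. \<sigma> e $$ (i, j) * nbw G N \<sigma> 0 (rev G e) j c) = (if N * org G e + i = c then 1 else 0)"
proof -
  have "(\<Sum>j<N. \<sigma> e $$ (i, j) * nbw G N \<sigma> 0 (rev G e) j c)
    = (if org G e = c div N then \<Sum>j<N. \<sigma> e $$ (i, j) * \<sigma> (rev G e) $$ (j, c mod N) else 0)"
    using assms by (simp add: edge)
  also have "\<dots> = (if org G e = c div N \<and> i = c mod N then 1 else 0)"
    unfolding color_mult_rev[OF assms mod_less_divisor[OF N_pos]] by auto
  also have "org G e = c div N \<and> i = c mod N \<longleftrightarrow> N * org G e + i = c"
    using assms(2) by auto
  finally show ?thesis .
qed

text \<open>The colors of \<open>e\<close> and \<open>rev G e\<close> cancel. What remains is a walk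
  from the origin of \<open>e\<close> whose first edge is not \<open>e\<close>, since it had to
  avoid the inverse of \<open>rev G e\<close>.\<close>

lemma backtrack_Suc:
  assumes "e < nE G" "i < N"
  shows "(\<Sum>j<N. \<sigma> e $$ (i, j) * nbw G N \<sigma> (Suc r) (rev G e) j c)
    = (\<Sum>f\<in>out_edges G (org G e) - {e}. nbw G N \<sigma> r f i c)"
proof -
  define S where "S k = (\<Sum>f\<in>out_edges G (org G e) - {e}. nbw G N \<sigma> r f k c)" for k
  have "(\<Sum>j<N. \<sigma> e $$ (i, j) * nbw G N \<sigma> (Suc r) (rev G e) j c)
    = (\<Sum>j<N. \<sigma> e $$ (i, j) * (\<Sum>k<N. \<sigma> (rev G e) $$ (j, k) * S k))"
    using assms by (simp add: edge S_def)
  also have "\<dots> = (\<Sum>k<N. (\<Sum>j<N. \<sigma> e $$ (i, j) * \<sigma> (rev G e) $$ (j, k)) * S k)"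
    unfolding sum_distrib_left sum_distrib_right mult.assoc by (rule sum.swap)
  also have "\<dots> = (\<Sum>k<N. if k = i then S k else 0)"
    using color_mult_rev[OF assms] by (intro sum.cong refl) auto
  also have "\<dots> = S i" using assms by simp
  finally show ?thesis by (simp add: S_def)
qed

text \<open>An edge \<open>e\<close> is put in front of a non-backtracking walk. If the walk does
  not begin with \<open>rev G e\<close>, the result is a longer non-backtracking walk; otherwise
  \<open>e\<close> cancels and the backtracking lemmas apply.\<close>

lemma nbm_recurrence:
  "col_adj_mat G N \<sigma> * nbm G N \<sigma> (Suc r) =
    nbm G N \<sigma> (Suc (Suc r)) + (if r = 0 then of_nat q + 1 else of_nat q) \<cdot>\<^sub>m nbm G N \<sigma> r"
proof (rule eq_matI)
  fix x c assume "x < dim_row (nbm G N \<sigma> (Suc (Suc r)) + (if r = 0 then of_nat q + 1 else of_nat q) \<cdot>\<^sub>m nbm G N \<sigma> r)"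
    "c < dim_col (nbm G N \<sigma> (Suc (Suc r)) + (if r = 0 then of_nat q + 1 else of_nat q) \<cdot>\<^sub>m nbm G N \<sigma> r)"
  then have xc: "x < N * nV G" "c < N * nV G" using nbm_carrier[of r] by auto
  define a i where ai: "a = x div N" "i = x mod N"
  have a: "a < nV G" and i: "i < N" and x: "x = N * a + i"
    using xc N_pos by (auto simp: ai less_mult_imp_div_less mult.commute)
  let ?B = "\<lambda>e. \<Sum>j<N. \<sigma> e $$ (i, j) * nbw G N \<sigma> r (rev G e) j c"
  have oe: "e < nE G" "org G e = a" if "e \<in> out_edges G a" for e
    using that by (auto simp: out_edges_def)
  have "(col_adj_mat G N \<sigma> * nbm G N \<sigma> (Suc r)) $$ (x, c)
    = (\<Sum>z<N * nV G. col_adj_mat G N \<sigma> $$ (x, z) * nbm G N \<sigma> (Suc r) $$ (z, c))"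
    using xc by (intro mat_mult_entry col_adj_mat_carrier nbm_carrier)
  also have "\<dots> = (\<Sum>e\<in>out_edges G a. \<Sum>j<N. \<sigma> e $$ (i, j) * nbm G N \<sigma> (Suc r) $$ (N * ter G e + j, c))"
    unfolding ai by (rule col_adj_mat_sum[OF xc(1)])
  also have "\<dots> = (\<Sum>e\<in>out_edges G a. nbw G N \<sigma> (Suc r) e i c + ?B e)"
  proof (rule sum.cong[OF refl])
    fix e assume "e \<in> out_edges G a"
    note e = oe[OF this]
    have "nbm G N \<sigma> (Suc r) $$ (N * ter G e + j, c)
      = (\<Sum>f\<in>out_edges G (ter G e) - {rev G e}. nbw G N \<sigma> r f j c) + nbw G N \<sigma> r (rev G e) j c" if j: "j < N" for j
    proof -
      have "N * ter G e + j < N * Suc (ter G e)" using j by simp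
      also have "\<dots> \<le> N * nV G" using edge(2)[OF e(1)] by (intro mult_left_mono) auto
      finally have "nbm G N \<sigma> (Suc r) $$ (N * ter G e + j, c) = (\<Sum>f\<in>out_edges G (ter G e). nbw G N \<sigma> r f j c)"
        using xc j by simp
      also have "\<dots> = nbw G N \<sigma> r (rev G e) j c + (\<Sum>f\<in>out_edges G (ter G e) - {rev G e}. nbw G N \<sigma> r f j c)"
        by (rule sum.remove) (use e in \<open>auto simp: out_edges_def edge\<close>)
      finally show ?thesis by (simp add: add.commute)
    qed
    then show "(\<Sum>j<N. \<sigma> e $$ (i, j) * nbm G N \<sigma> (Suc r) $$ (N * ter G e + j, c)) = nbw G N \<sigma> (Suc r) e i c + ?B e"
      by (simp add: distrib_left sum.distrib)
  qed
  also have "\<dots> = nbm G N \<sigma> (Suc (Suc r)) $$ (x, c) + (\<Sum>e\<in>out_edges G a. ?B e)"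
    using xc by (simp add: sum.distrib ai)
  also have "(\<Sum>e\<in>out_edges G a. ?B e) = (if r = 0 then of_nat q + 1 else of_nat q) * nbm G N \<sigma> r $$ (x, c)"
  proof (cases r)
    case 0
    have "(\<Sum>e\<in>out_edges G a. ?B e) = (\<Sum>e\<in>out_edges G a. if x = c then 1 else 0)"
      using backtrack_0[OF oe(1) i] oe(2) x 0 by (intro sum.cong refl) simp
    then show ?thesis using 0 xc card_out_edges[OF a] by simp
  next
    case (Suc s)
    let ?F = "\<lambda>f. nbw G N \<sigma> s f i c"
    have "(\<Sum>e\<in>out_edges G a. ?B e) = (\<Sum>e\<in>out_edges G a. (\<Sum>f\<in>out_edges G a. ?F f) - ?F e)"
      using backtrack_Suc[OF oe(1) i] oe(2) Suc by (intro sum.cong refl) (simp add: sum_diff1)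
    \<comment> \<open>A walk with first edge \<open>f\<close> survives the cancellation for every
      \<open>e\<close> at the vertex other than \<open>f\<close>, that is \<open>q\<close>
      times.\<close>
    also have "\<dots> = of_nat q * (\<Sum>f\<in>out_edges G a. ?F f)"
      using card_out_edges[OF a] by (simp add: sum_subtractf algebra_simps)
    finally show ?thesis using Suc xc by (simp add: ai)
  qed
  finally show "(col_adj_mat G N \<sigma> * nbm G N \<sigma> (Suc r)) $$ (x, c) =
    (nbm G N \<sigma> (Suc (Suc r)) + (if r = 0 then of_nat q + 1 else of_nat q) \<cdot>\<^sub>m nbm G N \<sigma> r) $$ (x, c)"
    using xc nbm_carrier[of r] nbm_carrier[of "Suc (Suc r)"] by simp
qed (use nbm_carrier[of r] nbm_carrier[of "Suc (Suc r)"] col_adj_mat_carrier in auto)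

text \<open>Arbitrary unitary \<open>U\<close> are allowed so that the color of the first edge can be absorbed into \<open>U\<close>
  in the induction.\<close>

lemma nbw_dominated:
  assumes "unitary_mat N U" "e < nE G"
  shows "cmod (\<Sum>i<N. \<Sum>j<N. U $$ (i, j) * nbw G N \<sigma> r e j (N * b + i)) \<le> real N * real (nbt G r e b)"
  using assms
proof (induction r arbitrary: U e)
  case 0
  let ?W = "U * \<sigma> e"
  have c: "U \<in> carrier_mat N N" "\<sigma> e \<in> carrier_mat N N"
    using 0 color_carrier by (auto simp: unitary_mat_def)
  have W: "unitary_mat N ?W" using 0 unitary unitary_mat_mult by blast
  show ?case
  proof (cases "ter G e = b")
    case True
    have "(\<Sum>i<N. \<Sum>j<N. U $$ (i, j) * nbw G N \<sigma> 0 e j (N * b + i)) = (\<Sum>i<N. ?W $$ (i, i))"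
      using True c by (intro sum.cong refl) (simp add: mat_mult_entry del: index_mult_mat)
    also have "cmod \<dots> \<le> (\<Sum>i<N. 1)"
      by (rule sum_norm_le) (use unitary_mat_entry_le[OF W] in auto)
    finally show ?thesis using True by simp
  qed simp
next
  case (Suc r)
  let ?W = "U * \<sigma> e"
  let ?S = "out_edges G (ter G e) - {rev G e}"
  have c: "U \<in> carrier_mat N N" "\<sigma> e \<in> carrier_mat N N"
    using Suc.prems color_carrier by (auto simp: unitary_mat_def)
  have W: "unitary_mat N ?W" using Suc.prems unitary unitary_mat_mult by blast
  have "(\<Sum>i<N. \<Sum>j<N. U $$ (i, j) * nbw G N \<sigma> (Suc r) e j (N * b + i))
    = (\<Sum>i<N. \<Sum>k<N. \<Sum>f\<in>?S. ?W $$ (i, k) * nbw G N \<sigma> r f k (N * b + i))"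
  proof (rule sum.cong[OF refl])
    fix i assume i: "i \<in> {..<N}"
    have "(\<Sum>j<N. U $$ (i, j) * nbw G N \<sigma> (Suc r) e j (N * b + i))
      = (\<Sum>j<N. \<Sum>k<N. U $$ (i, j) * \<sigma> e $$ (j, k) * (\<Sum>f\<in>?S. nbw G N \<sigma> r f k (N * b + i)))"
      by (simp add: sum_distrib_left mult.assoc)
    also have "\<dots> = (\<Sum>k<N. \<Sum>j<N. U $$ (i, j) * \<sigma> e $$ (j, k) * (\<Sum>f\<in>?S. nbw G N \<sigma> r f k (N * b + i)))"
      by (rule sum.swap)
    also have "\<dots> = (\<Sum>k<N. ?W $$ (i, k) * (\<Sum>f\<in>?S. nbw G N \<sigma> r f k (N * b + i)))"
      using i c by (intro sum.cong refl) (simp add: mat_mult_entry sum_distrib_right del: index_mult_mat)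
    finally show "(\<Sum>j<N. U $$ (i, j) * nbw G N \<sigma> (Suc r) e j (N * b + i))
      = (\<Sum>k<N. \<Sum>f\<in>?S. ?W $$ (i, k) * nbw G N \<sigma> r f k (N * b + i))"
      by (simp only: sum_distrib_left)
  qed
  also have "\<dots> = (\<Sum>i<N. \<Sum>f\<in>?S. \<Sum>k<N. ?W $$ (i, k) * nbw G N \<sigma> r f k (N * b + i))"
    by (intro sum.cong refl sum.swap)
  also have "\<dots> = (\<Sum>f\<in>?S. \<Sum>i<N. \<Sum>k<N. ?W $$ (i, k) * nbw G N \<sigma> r f k (N * b + i))"
    by (rule sum.swap)
  also have "cmod \<dots> \<le> (\<Sum>f\<in>?S. real N * real (nbt G r f b))"
    by (rule sum_norm_le) (rule Suc.IH[OF W], auto simp: out_edges_def)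
  also have "\<dots> = real N * real (nbt G (Suc r) e b)" by (simp add: sum_distrib_left)
  finally show ?case .
qed

lemma trace_nbm_Suc:
  "(\<Sum>x<N * nV G. nbm G N \<sigma> (Suc r) $$ (x, x)) =
    (\<Sum>a<nV G. \<Sum>f\<in>out_edges G a. \<Sum>i<N. nbw G N \<sigma> r f i (N * a + i))"
proof -
  have "(\<Sum>x<N * nV G. nbm G N \<sigma> (Suc r) $$ (x, x)) =
    (\<Sum>x<N * nV G. (\<lambda>a i. \<Sum>f\<in>out_edges G a. nbw G N \<sigma> r f i (N * a + i)) (x div N) (x mod N))"
    by (intro sum.cong refl) simp
  also have "\<dots> = (\<Sum>a<nV G. \<Sum>i<N. \<Sum>f\<in>out_edges G a. nbw G N \<sigma> r f i (N * a + i))"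
    by (rule sum_div_mod[OF N_pos])
  also have "\<dots> = (\<Sum>a<nV G. \<Sum>f\<in>out_edges G a. \<Sum>i<N. nbw G N \<sigma> r f i (N * a + i))"
    by (intro sum.cong refl sum.swap)
  finally show ?thesis .
qed

lemma trace_nbm_dominated:
  "cmod (\<Sum>x<N * nV G. nbm G N \<sigma> (Suc r) $$ (x, x)) \<le> real N * real (closed_nbt G r)"
proof -
  have "cmod (\<Sum>i<N. nbw G N \<sigma> r f i (N * a + i)) \<le> real N * real (nbt G r f a)" if "f < nE G" for f a
  proof -
    have "(\<Sum>i<N. \<Sum>j<N. 1\<^sub>m N $$ (i, j) * nbw G N \<sigma> r f j (N * a + i))
      = (\<Sum>i<N. \<Sum>j<N. if j = i then nbw G N \<sigma> r f j (N * a + i) else 0)"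
      by (intro sum.cong refl) auto
    also have "\<dots> = (\<Sum>i<N. nbw G N \<sigma> r f i (N * a + i))" by simp
    finally show ?thesis using nbw_dominated[OF unitary_mat_one that, of r a] by simp
  qed
  then have "cmod (\<Sum>x<N * nV G. nbm G N \<sigma> (Suc r) $$ (x, x))
    \<le> (\<Sum>a<nV G. \<Sum>f\<in>out_edges G a. real N * real (nbt G r f a))"
    unfolding trace_nbm_Suc by (intro sum_norm_le) (auto simp: out_edges_def)
  also have "\<dots> = real N * real (closed_nbt G r)"
    by (simp add: closed_nbt_def sum_distrib_left)
  finally show ?thesis .
qed

lemma nbw_trivial:
  assumes "\<And>e. e < nE G \<Longrightarrow> \<sigma> e = 1\<^sub>m N" "e < nE G" "i < N"
  shows "nbw G N \<sigma> r e i c = (if i = c mod N then of_nat (nbt G r e (c div N)) else 0)"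
  using assms(2,3)
proof (induction r arbitrary: e i)
  case 0
  then show ?case using assms(1) N_pos by simp
next
  case (Suc r)
  let ?S = "out_edges G (ter G e) - {rev G e}"
  have "nbw G N \<sigma> (Suc r) e i c = (\<Sum>j<N. if j = i then \<Sum>f\<in>?S. nbw G N \<sigma> r f j c else 0)"
    unfolding nbw.simps(2) assms(1)[OF Suc.prems(1)] using Suc.prems(2)
    by (intro sum.cong[OF refl]) simp
  also have "\<dots> = (\<Sum>f\<in>?S. nbw G N \<sigma> r f i c)" using Suc.prems by simp
  also have "\<dots> = (\<Sum>f\<in>?S. if i = c mod N then of_nat (nbt G r f (c div N)) else 0)"
    using Suc by (intro sum.cong refl) (auto simp: out_edges_def)
  finally show ?case by simp
qed

lemma trace_nbm_trivial:
  assumes "\<And>e. e < nE G \<Longrightarrow> \<sigma> e = 1\<^sub>m N"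
  shows "(\<Sum>x<N * nV G. nbm G N \<sigma> (Suc r) $$ (x, x)) = of_nat N * of_nat (closed_nbt G r)"
proof -
  have "(\<Sum>x<N * nV G. nbm G N \<sigma> (Suc r) $$ (x, x))
    = (\<Sum>a<nV G. \<Sum>f\<in>out_edges G a. \<Sum>i<N. of_nat (nbt G r f a))"
    unfolding trace_nbm_Suc using nbw_trivial[OF assms]
    by (intro sum.cong refl) (auto simp: out_edges_def)
  then show ?thesis by (simp add: closed_nbt_def sum_distrib_left)
qed

section \<open>Reality and boundedness of the spectrum\<close>

text \<open>Unitary matrices are isometries. The orthonormality of the columns of
  \<open>\<sigma> e\<close> that this needs is the row relation of the reversed edge.\<close>

lemma color_norm_preserving:
  assumes "e < nE G"
  shows "(\<Sum>i<N. (cmod (\<Sum>j<N. \<sigma> e $$ (i, j) * w j))\<^sup>2) = (\<Sum>j<N. (cmod (w j))\<^sup>2)"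
proof -
  have "complex_of_real (\<Sum>i<N. (cmod (\<Sum>j<N. \<sigma> e $$ (i, j) * w j))\<^sup>2)
    = (\<Sum>i<N. (\<Sum>j<N. \<sigma> e $$ (i, j) * w j) * cnj (\<Sum>k<N. \<sigma> e $$ (i, k) * w k))"
    by (simp only: of_real_sum complex_norm_square)
  \<comment> \<open>\<open>\<sigma> e\<close> is rewritten as the color of the doubly reversed edge
    so that \<open>color_mult_rev\<close> applies to \<open>rev G e\<close>.\<close>
  also have "\<dots> = (\<Sum>i<N. \<Sum>j<N. \<Sum>k<N. w j * cnj (w k) * (\<sigma> (rev G e) $$ (k, i) * \<sigma> (rev G (rev G e)) $$ (i, j)))"
    using assms by (intro sum.cong refl) (simp add: sum_product color_rev edge mult_ac)
  also have "\<dots> = (\<Sum>j<N. \<Sum>k<N. \<Sum>i<N. w j * cnj (w k) * (\<sigma> (rev G e) $$ (k, i) * \<sigma> (rev G (rev G e)) $$ (i, j)))"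
    by (rule sum_swap3)
  also have "\<dots> = (\<Sum>j<N. \<Sum>k<N. if k = j then w j * cnj (w k) else 0)"
    using color_mult_rev[OF edge(3)[OF assms]]
    by (intro sum.cong refl) (simp add: sum_distrib_left[symmetric])
  also have "\<dots> = complex_of_real (\<Sum>j<N. (cmod (w j))\<^sup>2)"
    by (simp add: complex_norm_square del: of_real_power)
  finally show ?thesis by (simp only: of_real_eq_iff)
qed

text \<open>Pairing an eigenvector with its image writes \<open>z\<close> times its squared norm as
  a sum of edge terms \<open>T e\<close>. Reversing an edge conjugates its term, so the sum is real;
  each term is at most the mean of the squared norms at the two ends, and every vertex is the origin
  of \<open>q + 1\<close> edges.\<close>

lemma eigenvalue_real_bounded:
  assumes "eigenvalue (col_adj_mat G N \<sigma>) z"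
  shows "Im z = 0" "\<bar>Re z\<bar> \<le> real q + 1"
proof -
  let ?A = "col_adj_mat G N \<sigma>" and ?n = "N * nV G"
  obtain v where v: "v \<in> carrier_vec ?n" "v \<noteq> 0\<^sub>v ?n" "?A *\<^sub>v v = z \<cdot>\<^sub>v v"
    using assms by (auto simp: eigenvalue_def eigenvector_def col_adj_mat_def)
  define w where "w a i = v $ (N * a + i)" for a i
  define s where "s a = (\<Sum>i<N. (cmod (w a i))\<^sup>2)" for a
  define S where "S = (\<Sum>a<nV G. s a)"
  define T where "T e = (\<Sum>i<N. \<Sum>j<N. cnj (w (org G e) i) * (\<sigma> e $$ (i, j) * w (ter G e) j))" for e
  have Sv: "S = (\<Sum>x<?n. (cmod (v $ x))\<^sup>2)"
    using sum_div_mod[OF N_pos, of "\<lambda>a i. (cmod (w a i))\<^sup>2" "nV G"] by (simp add: S_def s_def w_def)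
  have Spos: "S > 0"
  proof -
    obtain x where x: "x < ?n" "v $ x \<noteq> 0" using v(1,2) by (metis carrier_vecD eq_vecI index_zero_vec)
    have "(cmod (v $ x))\<^sup>2 \<le> S" unfolding Sv using x by (intro member_le_sum) auto
    moreover have "(cmod (v $ x))\<^sup>2 > 0" using x by simp
    ultimately show ?thesis by linarith
  qed
  have zS: "z * of_real S = (\<Sum>e<nE G. T e)"
  proof -
    have "z * of_real S = (\<Sum>x<?n. cnj (v $ x) * (z * v $ x))"
      unfolding Sv by (simp add: sum_distrib_left complex_norm_square mult_ac del: of_real_power)
    also have "\<dots> = (\<Sum>x<?n. cnj (v $ x) * (\<Sum>y<?n. ?A $$ (x, y) * v $ y))"
    proof (rule sum.cong[OF refl])
      fix x assume x: "x \<in> {..<?n}"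
      have "z * v $ x = (?A *\<^sub>v v) $ x" using v x by simp
      also have "\<dots> = (\<Sum>y<?n. ?A $$ (x, y) * v $ y)"
        using v(1) x col_adj_mat_carrier by (auto simp: scalar_prod_def atLeast0LessThan intro!: sum.cong)
      finally show "cnj (v $ x) * (z * v $ x) = cnj (v $ x) * (\<Sum>y<?n. ?A $$ (x, y) * v $ y)" by simp
    qed
    also have "\<dots> = (\<Sum>x<?n. (\<lambda>a i. cnj (w a i) * (\<Sum>e\<in>out_edges G a. \<Sum>j<N. \<sigma> e $$ (i, j) * w (ter G e) j)) (x div N) (x mod N))"
      using col_adj_mat_sum[of _ "\<lambda>y. v $ y"] by (intro sum.cong refl) (simp add: w_def)
    also have "\<dots> = (\<Sum>a<nV G. \<Sum>i<N. cnj (w a i) * (\<Sum>e\<in>out_edges G a. \<Sum>j<N. \<sigma> e $$ (i, j) * w (ter G e) j))"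
      by (rule sum_div_mod[OF N_pos])
    also have "\<dots> = (\<Sum>a<nV G. \<Sum>i<N. \<Sum>e\<in>out_edges G a. \<Sum>j<N. cnj (w a i) * (\<sigma> e $$ (i, j) * w (ter G e) j))"
      by (simp only: sum_distrib_left)
    also have "\<dots> = (\<Sum>a<nV G. \<Sum>e\<in>out_edges G a. \<Sum>i<N. \<Sum>j<N. cnj (w a i) * (\<sigma> e $$ (i, j) * w (ter G e) j))"
      by (intro sum.cong refl sum.swap)
    also have "\<dots> = (\<Sum>e<nE G. T e)" unfolding T_def by (rule sum_edges_org)
    finally show ?thesis .
  qed
  have cT: "cnj (T e) = T (rev G e)" if e: "e < nE G" for e
  proof -
    have "cnj (T e) = (\<Sum>i<N. \<Sum>j<N. cnj (w (ter G e) j) * (\<sigma> (rev G e) $$ (j, i) * w (org G e) i))"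
      using color_rev[OF e] unfolding T_def by (simp add: mult_ac)
    also have "\<dots> = T (rev G e)"
      unfolding T_def using e by (subst sum.swap) (simp add: edge)
    finally show ?thesis .
  qed
  have "cnj (z * of_real S) = z * of_real S"
    unfolding zS cnj_sum using cT sum_edges_rev[of T] by simp
  then have "cnj z = z" using Spos by simp
  then show Im: "Im z = 0" by (simp add: complex_eq_iff)
  have Tb: "cmod (T e) \<le> (s (org G e) + s (ter G e)) / 2" if e: "e < nE G" for e
  proof -
    define y where "y i = (\<Sum>j<N. \<sigma> e $$ (i, j) * w (ter G e) j)" for i
    have "T e = (\<Sum>i<N. cnj (w (org G e) i) * y i)" by (simp add: T_def y_def sum_distrib_left)
    also have "cmod \<dots> \<le> (\<Sum>i<N. ((cmod (w (org G e) i))\<^sup>2 + (cmod (y i))\<^sup>2) / 2)"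
    proof (rule sum_norm_le)
      fix i
      \<comment> \<open>The arithmetic-geometric mean inequality keeps the bound additive in the two
        end vertices, so that it can be summed over all edges.\<close>
      have "0 \<le> (cmod (w (org G e) i) - cmod (y i))\<^sup>2" by simp
      then show "cmod (cnj (w (org G e) i) * y i) \<le> ((cmod (w (org G e) i))\<^sup>2 + (cmod (y i))\<^sup>2) / 2"
        by (simp add: norm_mult power2_eq_square algebra_simps)
    qed
    also have "\<dots> = (s (org G e) + (\<Sum>i<N. (cmod (y i))\<^sup>2)) / 2"
      by (simp add: s_def sum.distrib sum_divide_distrib[symmetric])
    also have "(\<Sum>i<N. (cmod (y i))\<^sup>2) = s (ter G e)"
      unfolding y_def s_def by (rule color_norm_preserving[OF e])
    finally show ?thesis .
  qed
  have "cmod z * S = cmod (z * of_real S)" using Spos by (simp add: norm_mult)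
  also have "\<dots> \<le> (\<Sum>e<nE G. (s (org G e) + s (ter G e)) / 2)"
    unfolding zS by (rule sum_norm_le) (use Tb in auto)
  also have "\<dots> = ((\<Sum>e<nE G. s (org G e)) + (\<Sum>e<nE G. s (ter G e))) / 2"
    by (simp add: sum.distrib sum_divide_distrib[symmetric])
  also have "(\<Sum>e<nE G. s (ter G e)) = (\<Sum>e<nE G. s (org G e))"
    using sum_edges_rev[of "\<lambda>e. s (ter G e)"] by (simp add: edge)
  also have "(\<Sum>e<nE G. s (org G e)) = (real q + 1) * S"
    using sum_edges_org[of "\<lambda>a e. s a"] by (simp add: card_out_edges S_def sum_distrib_left add.commute)
  finally have "cmod z \<le> real q + 1" using Spos by simp
  then show "\<bar>Re z\<bar> \<le> real q + 1" using abs_Re_le_cmod[of z] by linarith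
qed

end

section \<open>Weak convergence with uniformly bounded supports\<close>

lemma continuous_on_km_poly [continuous_intros]:
  fixes f :: "'a::topological_space \<Rightarrow> real"
  assumes "continuous_on S f"
  shows "continuous_on S (\<lambda>x. km_poly q r (f x))"
proof -
  have "continuous_on UNIV (\<lambda>x::real. km_poly q r x) \<and> continuous_on UNIV (\<lambda>x::real. km_poly q (Suc r) x)"
    by (induction r) (auto intro!: continuous_intros)
  then show ?thesis
    by (auto intro: continuous_on_compose2[OF _ assms])
qed

lemma (in real_distribution) integrable_continuous_bounded_support:
  fixes f :: "real \<Rightarrow> real"
  assumes "AE x in M. \<bar>x\<bar> \<le> B" "continuous_on UNIV f"
  shows "integrable M f"
proof -
  have "compact (f ` {-B..B})"
    by (intro compact_continuous_image continuous_on_subset[OF assms(2)]) auto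
  then obtain C where "\<forall>y\<in>f ` {-B..B}. norm y \<le> C"
    using compact_imp_bounded bounded_iff by metis
  then have C: "norm (f x) \<le> C" if "x \<in> {-B..B}" for x using that by blast
  show ?thesis
  proof (rule integrable_const_bound)
    show "AE x in M. norm (f x) \<le> C" using assms(1) by eventually_elim (intro C, auto)
    show "f \<in> borel_measurable M" using borel_measurable_continuous_onI[OF assms(2)] by measurable
  qed
qed

lemma weak_conv_bounded_support:
  fixes f :: "real \<Rightarrow> real"
  assumes rd: "\<And>n. real_distribution (M_seq n)" "real_distribution M"
    and supp: "\<And>n. AE x in M_seq n. \<bar>x\<bar> \<le> B" "AE x in M. \<bar>x\<bar> \<le> B"
    and wc: "weak_conv_m M_seq M" and f: "continuous_on UNIV f"
  shows "(\<lambda>n. integral\<^sup>L (M_seq n) f) \<longlonglongrightarrow> integral\<^sup>L M f"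
proof -
  \<comment> \<open>Weak convergence tests bounded functions only. Clamping the argument to the
    common support makes \<open>f\<close> bounded and changes no integral.\<close>
  define g where "g x = f (max (-B) (min B x))" for x
  have cg: "continuous_on UNIV g"
    unfolding g_def by (intro continuous_on_compose2[OF f] continuous_intros) auto
  \<comment> \<open>The absolute value covers a negative \<open>B\<close>, for which the clamped
    argument is constantly \<open>- B\<close>.\<close>
  have "compact (f ` {-\<bar>B\<bar>..\<bar>B\<bar>})"
    by (intro compact_continuous_image continuous_on_subset[OF f]) auto
  then obtain C where "\<forall>y\<in>f ` {-\<bar>B\<bar>..\<bar>B\<bar>}. norm y \<le> C"
    using compact_imp_bounded bounded_iff by metis
  then have C: "norm (f x) \<le> C" if "x \<in> {-\<bar>B\<bar>..\<bar>B\<bar>}" for x using that by blast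
  have gC: "norm (g x) \<le> C" for x
    unfolding g_def by (rule C) (auto simp: max_def min_def)
  have "(\<lambda>n. integral\<^sup>L (M_seq n) g) \<longlonglongrightarrow> integral\<^sup>L M g"
    by (rule weak_conv_imp_integral_bdd_continuous_conv[OF rd wc _ gC])
       (use cg in \<open>auto simp: continuous_on_eq_continuous_at\<close>)
  moreover have "integral\<^sup>L N f = integral\<^sup>L N g" if "real_distribution N" "AE x in N. \<bar>x\<bar> \<le> B" for N
  proof -
    interpret real_distribution N by fact
    show ?thesis
    proof (rule integral_cong_AE)
      show "f \<in> borel_measurable N" "g \<in> borel_measurable N"
        using borel_measurable_continuous_onI[OF f] borel_measurable_continuous_onI[OF cg] by measurable
      show "AE x in N. f x = g x"
        using that(2) by eventually_elim (auto simp: g_def min_def max_def intro!: arg_cong[of _ _ f])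
    qed
  qed
  ultimately show ?thesis using rd supp by simp
qed

text \<open>Weak convergence can be tested on continuous step functions. On the common compact
  support these are uniformly approximated by polynomials (Weierstrass), whose integrals are
  combinations of moments.\<close>

lemma weak_conv_if_moments:
  fixes M_seq :: "nat \<Rightarrow> real measure"
  assumes rd: "\<And>n. real_distribution (M_seq n)" "real_distribution M"
    and supp: "\<And>n. AE x in M_seq n. \<bar>x\<bar> \<le> B" "AE x in M. \<bar>x\<bar> \<le> B"
    and mom: "\<And>k. (\<lambda>n. \<integral>x. x ^ k \<partial>M_seq n) \<longlonglongrightarrow> (\<integral>x. x ^ k \<partial>M)"
  shows "weak_conv_m M_seq M"
proof (rule integral_cts_step_conv_imp_weak_conv[OF rd])
  fix a b :: real assume "a < b"
  define f where "f = cts_step a b"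
  have f: "continuous_on UNIV f"
    unfolding f_def using \<open>a < b\<close> by (intro uniformly_continuous_imp_continuous cts_step_uniformly_continuous)
  show "(\<lambda>n. integral\<^sup>L (M_seq n) f) \<longlonglongrightarrow> integral\<^sup>L M f"
  proof (rule LIMSEQ_I)
    \<comment> \<open>One third each for the approximation under \<open>M_seq n\<close>, the
      approximation under \<open>M\<close>, and the convergence of the polynomial integrals.\<close>
    fix e :: real assume "0 < e"
    then have e3: "0 < e / 3" by simp
    obtain g where g: "real_polynomial_function g" "\<And>x. x \<in> {-B..B} \<Longrightarrow> \<bar>f x - g x\<bar> < e / 3"
      using Stone_Weierstrass_real_polynomial_function[OF _ continuous_on_subset[OF f] e3, of "{-B..B}"]
      by auto
    from real_polynomial_function_imp_sum[OF g(1)]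
    obtain c m where gs: "g = (\<lambda>x. \<Sum>i\<le>m. c i * x ^ i)" by blast
    have cg: "continuous_on UNIV g" unfolding gs by (intro continuous_intros)
    have gi: "integral\<^sup>L N g = (\<Sum>i\<le>m. c i * (\<integral>x. x ^ i \<partial>N))"
      if "real_distribution N" "AE x in N. \<bar>x\<bar> \<le> B" for N
    proof -
      have "integrable N (\<lambda>x::real. c i * x ^ i)" for i
        by (intro real_distribution.integrable_continuous_bounded_support[OF that] continuous_intros)
      then show ?thesis unfolding gs by simp
    qed
    have fg: "\<bar>integral\<^sup>L N f - integral\<^sup>L N g\<bar> \<le> e / 3"
      if "real_distribution N" "AE x in N. \<bar>x\<bar> \<le> B" for N
    proof -
      interpret real_distribution N by fact
      have i: "integrable N f" "integrable N g"
        by (intro integrable_continuous_bounded_support[OF that(2)] f cg)+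
      have "\<bar>integral\<^sup>L N f - integral\<^sup>L N g\<bar> = \<bar>\<integral>x. f x - g x \<partial>N\<bar>"
        using i by simp
      also have "\<dots> \<le> (\<integral>x. \<bar>f x - g x\<bar> \<partial>N)"
        by (rule integral_abs_bound)
      also have "\<dots> \<le> (\<integral>x. e / 3 \<partial>N)"
      proof (rule integral_mono_AE)
        show "AE x in N. \<bar>f x - g x\<bar> \<le> e / 3"
          using that(2) by eventually_elim (intro less_imp_le g, auto)
      qed (use i in auto)
      also have "\<dots> = e / 3" using prob_space by simp
      finally show ?thesis .
    qed
    have "(\<lambda>n. integral\<^sup>L (M_seq n) g) \<longlonglongrightarrow> integral\<^sup>L M g"
      unfolding gi[OF rd(1) supp(1)] gi[OF rd(2) supp(2)] by (intro tendsto_intros mom)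
    from LIMSEQ_D[OF this e3] obtain n0
      where n0: "\<And>n. n \<ge> n0 \<Longrightarrow> norm (integral\<^sup>L (M_seq n) g - integral\<^sup>L M g) < e / 3" by blast
    have "norm (integral\<^sup>L (M_seq n) f - integral\<^sup>L M f) < e" if "n \<ge> n0" for n
      using n0[OF that] fg[OF rd(1) supp(1), of n] fg[OF rd(2) supp(2)] unfolding real_norm_def by arith
    then show "\<exists>n0. \<forall>n\<ge>n0. norm (integral\<^sup>L (M_seq n) f - integral\<^sup>L M f) < e" by blast
  qed
qed

text \<open>For the converse the moments are recovered by trading a factor \<open>x\<close> for a
  shift of index: \<open>x\<close> times a polynomial of the family is a combination of its two
  neighbours. The induction therefore treats \<open>x ^ k\<close> times every member of the family
  at once.\<close>

lemma weak_conv_iff_km_poly: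
  fixes M_seq :: "nat \<Rightarrow> real measure"
  assumes q: "q \<ge> 1"
    and rd: "\<And>n. real_distribution (M_seq n)" "real_distribution M"
    and supp: "\<And>n. AE x in M_seq n. \<bar>x\<bar> \<le> B" "AE x in M. \<bar>x\<bar> \<le> B"
  shows "weak_conv_m M_seq M \<longleftrightarrow>
    (\<forall>r. (\<lambda>n. \<integral>x. km_poly q r (sqrt q * x) \<partial>M_seq n) \<longlonglongrightarrow> (\<integral>x. km_poly q r (sqrt q * x) \<partial>M))"
    (is "_ \<longleftrightarrow> (\<forall>r. ?C (\<lambda>x. km_poly q r (sqrt q * x)))")
proof
  assume "weak_conv_m M_seq M"
  then show "\<forall>r. ?C (\<lambda>x. km_poly q r (sqrt q * x))"
    by (intro allI weak_conv_bounded_support[OF rd supp] continuous_intros)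
next
  assume C: "\<forall>r. ?C (\<lambda>x. km_poly q r (sqrt q * x))"
  have lin: "?C (\<lambda>x. a * f x + b * g x)"
    if "?C f" "?C g" "continuous_on UNIV f" "continuous_on UNIV g" for a b and f g :: "real \<Rightarrow> real"
  proof -
    have "integral\<^sup>L N (\<lambda>x. a * f x + b * g x) = a * integral\<^sup>L N f + b * integral\<^sup>L N g"
      if "real_distribution N" "AE x in N. \<bar>x\<bar> \<le> B" for N
      using real_distribution.integrable_continuous_bounded_support[OF that \<open>continuous_on UNIV f\<close>]
        real_distribution.integrable_continuous_bounded_support[OF that \<open>continuous_on UNIV g\<close>] by simp
    then show ?thesis using rd supp that by (auto intro!: tendsto_intros)
  qed
  have rec: "x ^ Suc k * km_poly q (Suc r) (sqrt q * x) = (1 / sqrt q) * (x ^ k * km_poly q (Suc (Suc r)) (sqrt q * x))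
      + ((if r = 0 then real q + 1 else real q) / sqrt q) * (x ^ k * km_poly q r (sqrt q * x))" for r k and x :: real
    using q by (simp add: field_simps)
  have "?C (\<lambda>x. x ^ k * km_poly q r (sqrt q * x))" for k r
  proof (induction k arbitrary: r)
    case 0
    then show ?case using C by simp
  next
    case (Suc k)
    show ?case
    proof (cases r)
      case 0
      \<comment> \<open>At index 0 there is only one neighbour; the summand \<open>0 * 0\<close>
        brings the identity into the two-term form of \<open>lin\<close>.\<close>
      have "x ^ Suc k * km_poly q r (sqrt q * x) = (1 / sqrt q) * (x ^ k * km_poly q (Suc 0) (sqrt q * x)) + 0 * 0" for x
        using q 0 by simp
      then show ?thesis
        by (simp only:) (intro lin Suc.IH continuous_intros, auto)
    next
      case (Suc r')
      show ?thesis unfolding Suc rec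
        by (intro lin Suc.IH continuous_intros)
    qed
  qed
  from this[of _ 0] show "weak_conv_m M_seq M"
    by (intro weak_conv_if_moments[OF rd supp]) auto
qed

section \<open>Integrals against the Kesten--McKay distribution\<close>

lemma has_integral_cos_mult:
  "((\<lambda>t. cos (real k * t)) has_integral (if k = 0 then pi else 0)) {0..pi}"
proof (cases "k = 0")
  case True
  then show ?thesis using has_integral_const_real[of "1::real" 0 pi] by simp
next
  case False
  have "((\<lambda>t. cos (real k * t)) has_integral (sin (real k * pi) / k - sin (real k * 0) / k)) {0..pi}"
    by (rule fundamental_theorem_of_calculus)
       (use False in \<open>auto intro!: derivative_eq_intros simp: has_real_derivative_iff_has_vector_derivative[symmetric]\<close>)
  then show ?thesis using False by simp
qed

lemma has_integral_sin_sin_mult: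
  assumes "m \<ge> 1"
  shows "((\<lambda>t. sin t * sin (real m * t)) has_integral (if m = 1 then pi / 2 else 0)) {0..pi}"
proof -
  obtain k where k: "m = Suc k" using assms by (cases m) auto
  have "((\<lambda>t. (1/2) * (cos (real k * t) - cos (real (k + 2) * t))) has_integral
      (1/2) * ((if k = 0 then pi else 0) - (if k + 2 = 0 then pi else 0))) {0..pi}"
    by (intro has_integral_mult_right has_integral_diff has_integral_cos_mult)
  moreover have "(1/2) * (cos (real k * t) - cos (real (k + 2) * t)) = sin t * sin (real m * t)" for t
  proof -
    have "cos (real k * t) = cos (real m * t - t)" "cos (real (k + 2) * t) = cos (real m * t + t)"
      unfolding k by (auto simp: algebra_simps)
    then show ?thesis by (simp add: cos_add cos_diff)
  qed
  ultimately show ?thesis using k by (cases k) (simp_all only:, simp_all)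
qed

text \<open>Substituting \<open>x = - 2 cos t\<close> turns the Kesten--McKay denominator into \<open>q\<close> times the
  following expression with \<open>s = 1 / q\<close>.\<close>

definition km_den :: "real \<Rightarrow> real \<Rightarrow> real" where
  "km_den s t = 1 + s\<^sup>2 - 2 * s * cos (2 * t)"

lemma km_den_ge: 
  assumes "0 \<le> s" shows "(1 - s)\<^sup>2 \<le> km_den s t"
proof -
  have "2 * s * cos (2 * t) \<le> 2 * s * 1"
    using assms by (intro mult_left_mono) auto
  then show ?thesis unfolding km_den_def power2_eq_square by (simp add: algebra_simps)
qed

text \<open>Product-to-sum for \<open>cos (2 * t)\<close>: multiplying by the denominator couples
  sines whose indices differ by 2.\<close>

lemma km_den_sin:
  "km_den s t * sin (real (k + 2) * t) =
    (1 + s\<^sup>2) * sin (real (k + 2) * t) - s * sin (real (k + 4) * t) - s * sin (real k * t)"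
proof -
  define A where "A = real (k + 2) * t"
  have "real (k + 4) * t = A + 2 * t" "real k * t = A - 2 * t"
    by (auto simp: A_def algebra_simps)
  then show ?thesis
    unfolding A_def[symmetric] by (simp only: km_den_def sin_add sin_diff) (simp only: algebra_simps)
qed

text \<open>The same coupling at index 1, where the lower neighbour is
  \<open>sin (- t) = - sin t\<close> and folds back into the middle term.\<close>

lemma km_den_sin1: "km_den s t * sin t = (1 + s + s\<^sup>2) * sin t - s * sin (3 * t)"
proof -
  have e: "3 * t = 2 * t + t" by simp
  have "sin (3 * t) = sin (2 * t) * cos t + cos (2 * t) * sin t" unfolding e by (rule sin_add)
  moreover have "sin (2 * t) * cos t = 2 * sin t * (cos t)\<^sup>2" by (simp add: sin_double power2_eq_square)
  moreover have "2 * (cos t)\<^sup>2 = cos (2 * t) + 1" by (simp add: cos_double_cos)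
  ultimately have "sin (3 * t) = sin t * (2 * cos (2 * t) + 1)" by (simp add: algebra_simps)
  then show ?thesis by (simp add: km_den_def algebra_simps)
qed

text \<open>Cancelling the denominator gives a linear recurrence for \<open>I\<close> in steps of
  two, whose characteristic ratios for \<open>s > 0\<close> are \<open>s\<close> and
  \<open>1 / s\<close>. Boundedness of \<open>I\<close> excludes the growing solution, and the
  folded relation at index 1 fixes the scale.\<close>

lemma integral_sin_sin_km_den:
  fixes s :: real
  assumes s: "0 \<le> s" "s < 1"
  defines "I \<equiv> \<lambda>m::nat. integral {0..pi} (\<lambda>t. sin t * sin (real m * t) / km_den s t)"
  shows "((\<lambda>t. sin t * sin (real m * t) / km_den s t) has_integral I m) {0..pi}"
    and "I (k + 2) = s * I k" and "I 1 = pi / (2 * (1 + s))"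
proof -
  have pos: "km_den s t > 0" for t
    using s less_le_trans[OF _ km_den_ge[OF s(1)], of 0 t] by simp
  have cont: "continuous_on {0..pi} (\<lambda>t. sin t * sin (real m * t) / km_den s t)" for m
    by (intro continuous_intros) (use pos in \<open>auto simp: km_den_def intro!: continuous_intros\<close>, metis km_den_def less_irrefl)
  have hi: "((\<lambda>t. sin t * sin (real m * t) / km_den s t) has_integral I m) {0..pi}" for m
    unfolding I_def by (intro integrable_integral integrable_continuous_real cont)
  then show "((\<lambda>t. sin t * sin (real m * t) / km_den s t) has_integral I m) {0..pi}" .
  have bnd: "\<bar>I m\<bar> \<le> pi / (1 - s)\<^sup>2" for m
  proof -
    have "norm (sin t * sin (real m * t) / km_den s t) \<le> 1 / (1 - s)\<^sup>2" for t
    proof -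
      have "\<bar>sin t * sin (real m * t)\<bar> \<le> 1 * 1"
        unfolding abs_mult by (intro mult_mono) auto
      then have "\<bar>sin t * sin (real m * t)\<bar> / km_den s t \<le> 1 / (1 - s)\<^sup>2"
        using s km_den_ge[of s t] by (intro frac_le) auto
      then show ?thesis using pos[of t] by simp
    qed
    from has_integral_bound_real[OF _ _ hi[of m], of "1 / (1 - s)\<^sup>2" "{}"] this
    show ?thesis by simp
  qed
  \<comment> \<open>\<open>J\<close> is bounded and satisfies \<open>J k = s * J (k + 2)\<close> with \<open>s < 1\<close>, so it vanishes.\<close>
  define J where "J k = I (k + 2) - s * I k" for k
  have J: "J k = s * J (k + 2)" for k
  proof -
    have "((\<lambda>t. (1 + s\<^sup>2) * (sin t * sin (real (k + 2) * t) / km_den s t)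
        - s * (sin t * sin (real (k + 4) * t) / km_den s t) - s * (sin t * sin (real k * t) / km_den s t))
        has_integral (1 + s\<^sup>2) * I (k + 2) - s * I (k + 4) - s * I k) {0..pi}"
      by (intro has_integral_diff has_integral_mult_right hi)
    moreover have "(1 + s\<^sup>2) * (sin t * sin (real (k + 2) * t) / km_den s t)
        - s * (sin t * sin (real (k + 4) * t) / km_den s t) - s * (sin t * sin (real k * t) / km_den s t)
        = sin t * sin (real (k + 2) * t)" for t
    proof -
      have "(1 + s\<^sup>2) * (sin t * sin (real (k + 2) * t) / km_den s t)
        - s * (sin t * sin (real (k + 4) * t) / km_den s t) - s * (sin t * sin (real k * t) / km_den s t)
        = sin t * ((1 + s\<^sup>2) * sin (real (k + 2) * t) - s * sin (real (k + 4) * t) - s * sin (real k * t)) / km_den s t"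
        by (simp only: right_diff_distrib diff_divide_distrib mult.left_commute times_divide_eq_right)
      also have "\<dots> = sin t * sin (real (k + 2) * t)"
        unfolding km_den_sin[symmetric] using pos[of t] by simp
      finally show ?thesis .
    qed
    ultimately have "((\<lambda>t. sin t * sin (real (k + 2) * t)) has_integral
        (1 + s\<^sup>2) * I (k + 2) - s * I (k + 4) - s * I k) {0..pi}" by simp
    \<comment> \<open>The index \<open>k + 2\<close> is at least 2, so the sine is orthogonal to
      \<open>sin t\<close>.\<close>
    from has_integral_unique[OF this has_integral_sin_sin_mult[of "k + 2"]]
    have "(1 + s\<^sup>2) * I (k + 2) - s * I (k + 4) - s * I k = 0" by simp
    moreover have "J (k + 2) = I (k + 4) - s * I (k + 2)" unfolding J_def by (simp add: numeral_eq_Suc)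
    moreover have "I (k + 2) - s * I k = s * (I (k + 4) - s * I (k + 2))"
      if "(1 + s\<^sup>2) * I (k + 2) - s * I (k + 4) - s * I k = 0"
      using that by (simp add: algebra_simps power2_eq_square)
    ultimately show ?thesis unfolding J_def[of k] by simp
  qed
  have Jn: "J k = s ^ n * J (k + 2 * n)" for k n
  proof (induction n)
    case (Suc n)
    then show ?case using J[of "k + 2 * n"] by (simp add: mult.assoc mult.commute)
  qed simp
  have Jb: "\<bar>J k\<bar> \<le> 2 * (pi / (1 - s)\<^sup>2)" for k
  proof -
    have "\<bar>s * I k\<bar> \<le> 1 * (pi / (1 - s)\<^sup>2)"
      unfolding abs_mult using s bnd by (intro mult_mono) auto
    then show ?thesis unfolding J_def using bnd[of "k + 2"] abs_triangle_ineq4[of "I (k + 2)" "s * I k"] by linarith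
  qed
  have J0: "J k = 0" for k
  proof -
    have "(\<lambda>n. s ^ n * (2 * (pi / (1 - s)\<^sup>2))) \<longlonglongrightarrow> 0 * (2 * (pi / (1 - s)\<^sup>2))"
      using s by (intro tendsto_intros LIMSEQ_power_zero) auto
    moreover have "\<bar>J k\<bar> \<le> s ^ n * (2 * (pi / (1 - s)\<^sup>2))" for n
    proof -
      have "\<bar>J k\<bar> = s ^ n * \<bar>J (k + 2 * n)\<bar>" using s by (subst Jn[of k n]) (simp add: abs_mult)
      also have "\<dots> \<le> s ^ n * (2 * (pi / (1 - s)\<^sup>2))" using s Jb by (intro mult_left_mono) auto
      finally show ?thesis .
    qed
    ultimately have "\<bar>J k\<bar> \<le> 0" by (intro LIMSEQ_le_const[of _ 0]) auto
    then show ?thesis by simp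
  qed
  then show IS: "I (k + 2) = s * I k" for k using J_def by simp
  show "I 1 = pi / (2 * (1 + s))"
  proof -
    have "((\<lambda>t. (1 + s + s\<^sup>2) * (sin t * sin (real 1 * t) / km_den s t)
        - s * (sin t * sin (real 3 * t) / km_den s t))
        has_integral (1 + s + s\<^sup>2) * I 1 - s * I 3) {0..pi}"
      by (intro has_integral_diff has_integral_mult_right hi)
    moreover have "(1 + s + s\<^sup>2) * (sin t * sin (real 1 * t) / km_den s t)
        - s * (sin t * sin (real 3 * t) / km_den s t) = sin t * sin (real 1 * t)" for t
    proof -
      have "(1 + s + s\<^sup>2) * (sin t * sin (real 1 * t) / km_den s t)
        - s * (sin t * sin (real 3 * t) / km_den s t) = sin t * ((1 + s + s\<^sup>2) * sin t - s * sin (3 * t)) / km_den s t"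
        by (simp add: right_diff_distrib diff_divide_distrib mult.left_commute)
      also have "\<dots> = sin t * sin (real 1 * t)"
        unfolding km_den_sin1[symmetric] using pos[of t] by simp
      finally show ?thesis .
    qed
    ultimately have "((\<lambda>t. sin t * sin (real 1 * t)) has_integral
        (1 + s + s\<^sup>2) * I 1 - s * I 3) {0..pi}" by simp
    from has_integral_unique[OF this has_integral_sin_sin_mult[of 1]]
    have "(1 + s + s\<^sup>2) * I 1 - s * I 3 = pi / 2" by simp
    moreover have "I 3 = s * I 1" using IS[of 1] by (simp add: numeral_3_eq_3)
    ultimately have "(1 + s) * I 1 = pi / 2" by (simp add: algebra_simps power2_eq_square)
    then show ?thesis using s by (simp add: field_simps)
  qed
qed

text \<open>In Chebyshev polynomials of the second kind, \<open>km_poly\<close> at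
  \<open>n = r + 1\<close> is, up to its scale factor, \<open>U_n - U_(n-2) / q\<close>; multiplying
  by \<open>sin t\<close> avoids a division. Extended to index 0 the formula would give
  \<open>1 + 1 / q\<close> instead of 1, which is why it starts at \<open>Suc r\<close> and why the
  exceptional coefficient makes a second base case necessary.\<close>

lemma km_poly_cos_sin:
  fixes t :: real
  assumes "q \<ge> 1"
  shows "km_poly q (Suc r) (sqrt q * (- 2 * cos t)) * sin t =
    (- sqrt q) ^ Suc r * (sin (real (r + 2) * t) - sin (real r * t) / q)"
proof -
  have sq: "sqrt q * sqrt q = q" by simp
  let ?P = "\<lambda>r. km_poly q (Suc r) (sqrt q * (- 2 * cos t)) * sin t =
    (- sqrt q) ^ Suc r * (sin (real (r + 2) * t) - sin (real r * t) / q)"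
  have tw: "sin (real (k + 2) * t) = 2 * cos t * sin (real (k + 1) * t) - sin (real k * t)" for k
  proof -
    have "sin (real (k + 2) * t) = sin (real (k + 1) * t + t)" "sin (real k * t) = sin (real (k + 1) * t - t)"
      by (auto simp: algebra_simps)
    then show ?thesis by (simp add: sin_add sin_diff)
  qed
  have P0: "?P 0" using tw[of 0] by simp
  have P1: "?P (Suc 0)"
  proof -
    have "km_poly q (Suc (Suc 0)) (sqrt q * (- 2 * cos t)) * sin t = ((sqrt q * sqrt q) * (4 * (cos t)\<^sup>2) - (q + 1)) * sin t"
      by (simp add: power2_eq_square algebra_simps)
    also have "\<dots> = q * ((4 * (cos t)\<^sup>2 * sin t - sin t) - sin t / q)"
      unfolding sq using assms by (simp add: field_simps)
    also have "4 * (cos t)\<^sup>2 * sin t - sin t = sin (real (Suc 0 + 2) * t)"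
      using tw[of 1] tw[of 0] by (simp add: power2_eq_square)
    also have "q * (sin (real (Suc 0 + 2) * t) - sin t / q) = (- sqrt q) ^ Suc (Suc 0) * (sin (real (Suc 0 + 2) * t) - sin (real (Suc 0) * t) / q)"
      using sq by simp
    finally show ?thesis .
  qed
  have step: "?P (Suc (Suc r))" if "?P r" "?P (Suc r)" for r
  proof -
    have "km_poly q (Suc (Suc (Suc r))) (sqrt q * (- 2 * cos t)) * sin t =
       (sqrt q * (- 2 * cos t)) * (km_poly q (Suc (Suc r)) (sqrt q * (- 2 * cos t)) * sin t)
        - q * (km_poly q (Suc r) (sqrt q * (- 2 * cos t)) * sin t)"
      by (simp add: algebra_simps)
    also have "\<dots> = (- sqrt q) ^ Suc (Suc (Suc r)) *
      ((2 * cos t * sin (real (Suc r + 2) * t) - sin (real (r + 2) * t)) - (2 * cos t * sin (real (Suc r) * t) - sin (real r * t)) / q)"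
    proof -
      have pw: "(- sqrt q) ^ Suc (Suc r) = q * (- sqrt q) ^ r"
        "(- sqrt q) ^ Suc (Suc (Suc r)) = - sqrt q * q * (- sqrt q) ^ r"
        using sq by (simp_all flip: mult.assoc)
      have alg: "(u * (- 2 * c)) * ((Q * P) * (a - B)) - Q * ((- u * P) * (a' - B'))
        = (- u * Q * P) * ((2 * c * a - a') - (2 * c * B - B'))" for u c Q P a B a' B' :: real
        by (simp add: algebra_simps)
      show ?thesis
        unfolding that pw power_Suc[of "- sqrt q" r] diff_divide_distrib[of "2 * cos t * sin (real (Suc r) * t)"]
          times_divide_eq_right[symmetric, of "2 * cos t"] by (rule alg)
    qed
    also have "2 * cos t * sin (real (Suc r + 2) * t) - sin (real (r + 2) * t) = sin (real (Suc (Suc r) + 2) * t)"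
      using tw[of "r + 2"] by simp
    also have "2 * cos t * sin (real (Suc r) * t) - sin (real r * t) = sin (real (Suc (Suc r)) * t)"
      using tw[of "r"] by simp
    finally show ?thesis .
  qed
  have "?P r \<and> ?P (Suc r)" by (induction r) (use P0 P1 step in blast)+
  then show ?thesis by blast
qed

text \<open>For \<open>q > 1\<close> the Chebyshev form produces exactly the combination
  \<open>I (k + 2) - s * I k\<close>, which vanishes. For \<open>q = 1\<close> the denominator is
  \<open>4 * (sin t)^2\<close>, and the integrand reduces to a multiple of a cosine between the
  endpoints.\<close>

lemma has_integral_km_poly_km_den:
  assumes q: "q \<ge> 1"
  shows "((\<lambda>t. km_poly q r (sqrt q * (- 2 * cos t)) * ((sin t)\<^sup>2 / km_den (1 / q) t)) has_integral
     (if r = 0 then pi / (2 * (1 + 1 / q)) else 0)) {0..pi}"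
proof (cases "q = 1")
  case True
  have den: "km_den 1 t = 4 * (sin t)\<^sup>2" for t
    by (simp add: km_den_def cos_double_sin)
  \<comment> \<open>The denominator vanishes at \<open>0\<close> and \<open>pi\<close>, so the integrands agree only in between.\<close>
  show ?thesis
  proof (cases r)
    case 0
    have "((\<lambda>t. 1/4) has_integral pi / 4) {0..pi}"
      using has_integral_const_real[of "1/4::real" 0 pi] by simp
    then have "((\<lambda>t. km_poly q r (sqrt q * (- 2 * cos t)) * ((sin t)\<^sup>2 / km_den (1 / q) t)) has_integral pi / 4) {0..pi}"
    proof (rule has_integral_spike_finite[rotated 2, where S="{0, pi}"])
      fix t assume "t \<in> {0..pi} - {0, pi}"
      then have "sin t > 0" by (intro sin_gt_zero) auto
      then show "km_poly q r (sqrt q * (- 2 * cos t)) * ((sin t)\<^sup>2 / km_den (1 / q) t) = 1/4"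
        using True 0 by (simp add: den)
    qed auto
    then show ?thesis using 0 True by simp
  next
    case (Suc k)
    have "((\<lambda>t. (- 1) ^ r / 2 * cos (real r * t)) has_integral (- 1) ^ r / 2 * 0) {0..pi}"
      using has_integral_cos_mult[of r] Suc by (intro has_integral_mult_right) simp
    then have "((\<lambda>t. km_poly q r (sqrt q * (- 2 * cos t)) * ((sin t)\<^sup>2 / km_den (1 / q) t)) has_integral (- 1) ^ r / 2 * 0) {0..pi}"
    proof (rule has_integral_spike_finite[rotated 2, where S="{0, pi}"])
      fix t assume "t \<in> {0..pi} - {0, pi}"
      then have s: "sin t > 0" by (intro sin_gt_zero) auto
      have "sin (real (k + 2) * t) = sin (real r * t + t)" "sin (real k * t) = sin (real r * t - t)"
        using Suc by (auto simp: algebra_simps)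
      then have "sin (real (k + 2) * t) - sin (real k * t) = 2 * cos (real r * t) * sin t"
        by (simp add: sin_add sin_diff)
      with km_poly_cos_sin[OF q, of k t] have "km_poly q r (sqrt q * (- 2 * cos t)) * sin t = (-1) ^ r * (2 * cos (real r * t)) * sin t"
        using Suc True by simp
      then have "km_poly q r (sqrt q * (- 2 * cos t)) = (-1) ^ r * (2 * cos (real r * t))"
        using s by simp
      then show "km_poly q r (sqrt q * (- 2 * cos t)) * ((sin t)\<^sup>2 / km_den (1 / q) t) = (- 1) ^ r / 2 * cos (real r * t)"
        using True s by (simp add: den)
    qed auto
    then show ?thesis using Suc by simp
  qed
next
  case False
  define s where "s = 1 / real q"
  have s: "0 \<le> s" "s < 1" using False q by (auto simp: s_def)
  note I = integral_sin_sin_km_den[OF s]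
  show ?thesis
  proof (cases r)
    case 0
    have "((\<lambda>t. sin t * sin (real 1 * t) / km_den s t) has_integral pi / (2 * (1 + s))) {0..pi}"
      using I(1)[of 1] unfolding I(3) .
    then show ?thesis using 0 by (simp add: s_def power2_eq_square)
  next
    case (Suc k)
    have "((\<lambda>t. (- sqrt q) ^ r * (sin t * sin (real (k + 2) * t) / km_den s t - s * (sin t * sin (real k * t) / km_den s t)))
      has_integral (- sqrt q) ^ r * (integral {0..pi} (\<lambda>t. sin t * sin (real (k + 2) * t) / km_den s t)
        - s * integral {0..pi} (\<lambda>t. sin t * sin (real k * t) / km_den s t))) {0..pi}"
      by (intro has_integral_mult_right has_integral_diff I(1))
    moreover have "(- sqrt q) ^ r * (sin t * sin (real (k + 2) * t) / km_den s t - s * (sin t * sin (real k * t) / km_den s t))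
       = km_poly q r (sqrt q * (- 2 * cos t)) * ((sin t)\<^sup>2 / km_den (1 / q) t)" for t
    proof -
      have "km_poly q r (sqrt q * (- 2 * cos t)) * ((sin t)\<^sup>2 / km_den (1 / q) t)
        = (km_poly q r (sqrt q * (- 2 * cos t)) * sin t) * (sin t / km_den s t)"
        by (simp add: s_def power2_eq_square)
      also have "\<dots> = (- sqrt q) ^ r * (sin (real (k + 2) * t) - s * sin (real k * t)) * (sin t / km_den s t)"
        unfolding Suc km_poly_cos_sin[OF q] by (simp add: s_def)
      also have "\<dots> = (- sqrt q) ^ r * (sin t * sin (real (k + 2) * t) / km_den s t - s * (sin t * sin (real k * t) / km_den s t))"
        by (simp only: right_diff_distrib left_diff_distrib diff_divide_distrib times_divide_eq_right times_divide_eq_left mult_ac)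
      finally show ?thesis by simp
    qed
    ultimately show ?thesis unfolding I(2) using Suc by simp
  qed
qed

section \<open>The density under the substitution x = - 2 cos t\<close>

lemma kesten_mckay_density_nonneg:
  assumes "q \<ge> 1"
  shows "kesten_mckay_density q x \<ge> 0"
proof (cases "\<bar>x\<bar> \<le> 2")
  case True
  have x: "x\<^sup>2 \<le> 4" using True abs_le_square_iff[of x 2] by simp
  \<comment> \<open>The denominator factor is thus at least \<open>4 - x\<^sup>2\<close>. It can be
    0 when \<open>q = 1\<close> and \<open>\<bar>x\<bar> = 2\<close>, where division by zero gives
    density 0.\<close>
  have "(1 / sqrt q + sqrt q)\<^sup>2 = (1 / sqrt q - sqrt q)\<^sup>2 + 4"
    using assms by (simp add: power2_eq_square algebra_simps)
  then have "(1 / sqrt q + sqrt q)\<^sup>2 - x\<^sup>2 \<ge> 0" using x by (simp add: add.commute add_increasing2)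
  then show ?thesis using x by (simp add: kesten_mckay_density_def)
qed (simp add: kesten_mckay_density_def)

text \<open>The factor \<open>2 * sin t\<close> is the derivative of \<open>- 2 * cos t\<close>; the
  minus sign makes the substitution increasing on \<open>{0..pi}\<close>.\<close>

lemma kesten_mckay_density_cos:
  assumes q: "q \<ge> 1" and t: "t \<in> {0..pi}"
  shows "kesten_mckay_density q (- 2 * cos t) * (2 * sin t) =
    2 * (1 + 1 / q) / pi * ((sin t)\<^sup>2 / km_den (1 / q) t)"
proof -
  have "sqrt (4 - (- 2 * cos t)\<^sup>2) = sqrt ((2 * sin t)\<^sup>2)"
    by (simp add: power_mult_distrib cos_squared_eq)
  also have "\<dots> = 2 * sin t" unfolding real_sqrt_abs using t sin_ge_zero[of t] by simp
  finally have r: "sqrt (4 - (- 2 * cos t)\<^sup>2) = 2 * sin t" .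
  have "(1 / sqrt q + sqrt q)\<^sup>2 - (- 2 * cos t)\<^sup>2 = 1 / q + 2 + q - 4 * (cos t)\<^sup>2"
    using q by (simp add: power2_sum power_mult_distrib power_divide)
  also have "\<dots> = q * km_den (1 / q) t"
    unfolding km_den_def cos_double_cos using q by (simp add: field_simps power2_eq_square)
  finally have d: "(1 / sqrt q + sqrt q)\<^sup>2 - (- 2 * cos t)\<^sup>2 = q * km_den (1 / q) t" .
  have "\<bar>- 2 * cos t\<bar> \<le> 2" by (simp add: abs_mult)
  then have "kesten_mckay_density q (- 2 * cos t) * (2 * sin t) =
    (real q + 1) * (2 * sin t) / (2 * pi * (q * km_den (1 / q) t)) * (2 * sin t)"
    unfolding kesten_mckay_density_def r d by simp
  also have "\<dots> = 2 * ((real q + 1) / q) / pi * ((sin t)\<^sup>2 / km_den (1 / q) t)"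
  proof -
    \<comment> \<open>The case \<open>D = 0\<close> occurs for \<open>q = 1\<close> at the
      endpoints; both sides are then 0 by the convention for division by zero.\<close>
    have "Q * (2 * S) / (2 * pi * (x * D)) * (2 * S) = 2 * (Q / x) / pi * (S\<^sup>2 / D)" for Q S x D :: real
      by (cases "x = 0"; cases "D = 0") (auto simp: field_simps power2_eq_square)
    then show ?thesis .
  qed
  also have "(real q + 1) / q = 1 + 1 / q" using q by (simp add: field_simps)
  finally show ?thesis .
qed

lemma kesten_mckay_density_measurable [measurable]: "kesten_mckay_density q \<in> borel_measurable borel"
  unfolding kesten_mckay_density_def by measurable

lemma nn_integral_kesten_mckay_density:
  assumes q: "q \<ge> 1"
  shows "(\<integral>\<^sup>+x. ennreal (kesten_mckay_density q x) \<partial>lborel) = 1"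
proof -
  have "(\<integral>\<^sup>+x. ennreal (kesten_mckay_density q x) \<partial>lborel)
    = (\<integral>\<^sup>+x. kesten_mckay_density q x * indicator {- 2 * cos 0..- 2 * cos pi} x \<partial>lborel)"
    by (intro nn_integral_cong) (auto simp: kesten_mckay_density_def split: split_indicator)
  also have "\<dots> = (\<integral>\<^sup>+t. kesten_mckay_density q (- 2 * cos t) * (2 * sin t) * indicator {0..pi} t \<partial>lborel)"
    by (rule nn_integral_substitution[where g = "\<lambda>t. - 2 * cos t"])
       (auto intro!: derivative_eq_intros continuous_intros sin_ge_zero simp: set_borel_measurable_def)
  \<comment> \<open>The factor \<open>km_poly q 0\<close>, which equals 1, is inserted so that the
    total mass becomes the index 0 case of the integral already computed.\<close>
  also have "\<dots> = (\<integral>\<^sup>+t. ennreal (if t \<in> {0..pi} then 2 * (1 + 1 / q) / pi * (km_poly q 0 (sqrt q * (- 2 * cos t)) * ((sin t)\<^sup>2 / km_den (1 / q) t)) else 0) \<partial>lborel)"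
    by (intro nn_integral_cong) (use kesten_mckay_density_cos[OF q] in \<open>auto split: split_indicator\<close>)
  also have "\<dots> = ennreal (2 * (1 + 1 / q) / pi * (pi / (2 * (1 + 1 / q))))"
  proof (rule nn_integral_has_integral_lborel)
    show "(\<lambda>t. if t \<in> {0..pi} then 2 * (1 + 1 / q) / pi * (km_poly q 0 (sqrt q * (- 2 * cos t)) * ((sin t)\<^sup>2 / km_den (1 / q) t)) else 0) \<in> borel_measurable borel"
      unfolding km_den_def km_poly.simps by measurable
    show "0 \<le> (if t \<in> {0..pi} then 2 * (1 + 1 / q) / pi * (km_poly q 0 (sqrt q * (- 2 * cos t)) * ((sin t)\<^sup>2 / km_den (1 / q) t)) else 0)" for t
      using km_den_ge[of "1 / q" t] order_trans[OF zero_le_power2, of "1 - 1 / real q" "km_den (1 / q) t"] by simp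
    show "((\<lambda>t. if t \<in> {0..pi} then 2 * (1 + 1 / q) / pi * (km_poly q 0 (sqrt q * (- 2 * cos t)) * ((sin t)\<^sup>2 / km_den (1 / q) t)) else 0)
      has_integral 2 * (1 + 1 / q) / pi * (pi / (2 * (1 + 1 / q)))) UNIV"
      unfolding has_integral_restrict_UNIV
    proof (rule has_integral_mult_right)
      show "((\<lambda>t. km_poly q 0 (sqrt q * (- 2 * cos t)) * ((sin t)\<^sup>2 / km_den (1 / q) t)) has_integral pi / (2 * (1 + 1 / q))) {0..pi}"
        using has_integral_km_poly_km_den[OF q, of 0] by (simp only: if_True simp_thms)
    qed
  qed
  also have "2 * (1 + 1 / q) / pi * (pi / (2 * (1 + 1 / q))) = 1"
  proof -
    have *: "2 * A / pi * (pi / (2 * A)) = 1" if "A > 0" for A :: real using that by simp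
    show ?thesis by (rule *) (intro add_pos_nonneg; simp)
  qed
  finally show ?thesis by simp
qed

lemma real_distribution_kesten_mckay:
  assumes "q \<ge> 1"
  shows "real_distribution (kesten_mckay q)"
  unfolding real_distribution_def real_distribution_axioms_def
proof
  show "prob_space (kesten_mckay q)"
    by (rule prob_spaceI)
       (simp add: kesten_mckay_def emeasure_density nn_integral_kesten_mckay_density[OF assms] cong: nn_integral_cong)
qed (simp add: kesten_mckay_def)

lemma AE_kesten_mckay: "AE x in kesten_mckay q. \<bar>x\<bar> \<le> 2"
  unfolding kesten_mckay_def by (subst AE_density) (auto simp: kesten_mckay_density_def)

lemma km_poly_measurable [measurable]:
  assumes "f \<in> borel_measurable M"
  shows "(\<lambda>x. km_poly q r (f x) :: real) \<in> borel_measurable M"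
proof -
  have "(\<lambda>x. km_poly q r (f x)) \<in> borel_measurable M \<and> (\<lambda>x. km_poly q (Suc r) (f x)) \<in> borel_measurable M"
    by (induction r) (use assms in auto)
  then show ?thesis by blast
qed

text \<open>Integrability is assumed because the substitution rule for Lebesgue integrals asks for
  it; callers obtain it from the bounded support.\<close>

lemma integral_km_poly_kesten_mckay:
  assumes q: "q \<ge> 1" and int: "integrable (kesten_mckay q) (\<lambda>x. km_poly q (Suc r) (sqrt q * x))"
  shows "(\<integral>x. km_poly q (Suc r) (sqrt q * x) \<partial>kesten_mckay q) = 0"
proof -
  let ?d = "kesten_mckay_density q" and ?p = "\<lambda>x. km_poly q (Suc r) (sqrt q * x)"
  have nn: "AE x in lborel. 0 \<le> ?d x" using kesten_mckay_density_nonneg[OF q] by simp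
  have "integrable lborel (\<lambda>x. ?d x * ?p x)"
    using int nn unfolding kesten_mckay_def by (subst (asm) integrable_real_density) auto
  then have si: "set_integrable lborel {- 2 * cos 0..- 2 * cos pi} (\<lambda>x. ?d x * ?p x)"
    unfolding set_integrable_def by (rule integrable_mult_indicator[rotated]) simp
  have "(\<integral>x. ?p x \<partial>kesten_mckay q) = (\<integral>x. ?d x * ?p x \<partial>lborel)"
    using nn unfolding kesten_mckay_def by (subst integral_real_density) auto
  \<comment> \<open>The density vanishes outside [-2, 2]; the ends are written as
    \<open>- 2 * cos 0\<close> and \<open>- 2 * cos pi\<close> to match the substitution
    rule.\<close>
  also have "\<dots> = (LBINT x. (?d x * ?p x) * indicator {- 2 * cos 0..- 2 * cos pi} x)"
    by (intro Bochner_Integration.integral_cong refl) (auto simp: kesten_mckay_density_def split: split_indicator)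
  also have "\<dots> = (LBINT t. (?d (- 2 * cos t) * ?p (- 2 * cos t)) * (2 * sin t) * indicator {0..pi} t)"
    by (rule integral_substitution(2)[where g = "\<lambda>t. - 2 * cos t", OF si])
       (auto intro!: derivative_eq_intros continuous_intros sin_ge_zero)
  also have "\<dots> = (LBINT t:{0..pi}. (?d (- 2 * cos t) * ?p (- 2 * cos t)) * (2 * sin t))"
    by (simp add: set_lebesgue_integral_def mult.commute)
  also have "\<dots> = integral {0..pi} (\<lambda>t. (?d (- 2 * cos t) * ?p (- 2 * cos t)) * (2 * sin t))"
    by (rule set_borel_integral_eq_integral(2), rule integral_substitution(1)[where g = "\<lambda>t. - 2 * cos t", OF si])
       (auto intro!: derivative_eq_intros continuous_intros sin_ge_zero)
  also have "\<dots> = integral {0..pi} (\<lambda>t. 2 * (1 + 1 / q) / pi * (?p (- 2 * cos t) * ((sin t)\<^sup>2 / km_den (1 / q) t)))"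
  proof (intro Henstock_Kurzweil_Integration.integral_cong)
    fix t assume "t \<in> {0..pi}"
    have "(?d (- 2 * cos t) * ?p (- 2 * cos t)) * (2 * sin t) = ?p (- 2 * cos t) * (?d (- 2 * cos t) * (2 * sin t))"
      by (simp only: mult_ac)
    also have "\<dots> = 2 * (1 + 1 / q) / pi * (?p (- 2 * cos t) * ((sin t)\<^sup>2 / km_den (1 / q) t))"
      unfolding kesten_mckay_density_cos[OF q \<open>t \<in> {0..pi}\<close>] by (simp only: mult_ac)
    finally show "(?d (- 2 * cos t) * ?p (- 2 * cos t)) * (2 * sin t)
      = 2 * (1 + 1 / q) / pi * (?p (- 2 * cos t) * ((sin t)\<^sup>2 / km_den (1 / q) t))" .
  qed
  also have "\<dots> = 2 * (1 + 1 / q) / pi * 0"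
  proof (intro integral_unique has_integral_mult_right)
    show "((\<lambda>t. ?p (- 2 * cos t) * ((sin t)\<^sup>2 / km_den (1 / q) t)) has_integral 0) {0..pi}"
      using has_integral_km_poly_km_den[OF q, of "Suc r"] by (simp only: nat.simps if_False)
  qed
  finally show ?thesis by simp
qed

section \<open>Spectral measures of colored graphs\<close>

text \<open>Makes the uncolored graph the case \<open>N = 1\<close> with trivial color, so that one
  spectral analysis covers both.\<close>

lemma adj_mat_eq_col_adj_mat: "adj_mat G = col_adj_mat G 1 (\<lambda>_. 1\<^sub>m 1)"
  by (rule eq_matI) (auto simp: adj_mat_def col_adj_mat_def)

context colored_graph
begin

abbreviation eigs :: "complex multiset" where
  "eigs \<equiv> proots (char_poly (col_adj_mat G N \<sigma>))"

lemma nV_pos: "nV G > 0"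
  using reg by (simp add: regular_graph_def wf_graph_def)

lemma size_eigs: "size eigs = N * nV G"
  using degree_monic_char_poly[OF col_adj_mat_carrier] by (simp add: size_proots_complex)

lemma eigs_nonempty: "eigs \<noteq> {#}"
  using size_eigs N_pos nV_pos by auto

lemma eigs_real_bounded:
  assumes "z \<in># eigs"
  shows "Im z = 0" "\<bar>Re z\<bar> \<le> real q + 1"
proof -
  have "char_poly (col_adj_mat G N \<sigma>) \<noteq> 0" using degree_monic_char_poly[OF col_adj_mat_carrier] by auto
  then have "eigenvalue (col_adj_mat G N \<sigma>) z"
    using assms by (simp add: eigenvalue_root_char_poly[OF col_adj_mat_carrier])
  then show "Im z = 0" "\<bar>Re z\<bar> \<le> real q + 1" by (rule eigenvalue_real_bounded)+
qed

lemma real_distribution_mu_col: "real_distribution (mu_col q G N \<sigma>)"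
  unfolding mu_col_def spec_measure_def real_distribution_def real_distribution_axioms_def
  by (intro conjI measure_pmf.prob_space_distr) auto

lemma AE_mu_col: "AE x in mu_col q G N \<sigma>. \<bar>x\<bar> \<le> (real q + 1) / sqrt q"
proof -
  let ?M = "image_mset (\<lambda>z. Re z / sqrt (real q)) eigs"
  have "\<bar>x\<bar> \<le> (real q + 1) / sqrt q" if "x \<in># ?M" for x
    using that eigs_real_bounded(2) by (auto intro!: divide_right_mono)
  then have "AE x in measure_pmf (pmf_of_multiset ?M). \<bar>id x\<bar> \<le> (real q + 1) / sqrt q"
    using eigs_nonempty by (simp add: AE_measure_pmf_iff)
  then show ?thesis
    unfolding mu_col_def spec_measure_def by (subst AE_distr_iff) auto
qed

text \<open>The factor \<open>sqrt q\<close> undoes the scaling in \<open>spec_measure\<close>, and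
  taking real parts loses nothing because the eigenvalues are real. The eigenvalue sum is then the
  trace of a walk matrix.\<close>

lemma integral_km_poly_mu_col:
  assumes q: "q \<ge> 1"
  shows "of_real (\<integral>x. km_poly q r (sqrt q * x) \<partial>mu_col q G N \<sigma>) =
    (\<Sum>x<N * nV G. nbm G N \<sigma> r $$ (x, x)) / of_nat (N * nV G)"
proof -
  let ?M = "image_mset (\<lambda>z. Re z / sqrt (real q)) eigs"
  have "(\<integral>x. km_poly q r (sqrt q * x) \<partial>mu_col q G N \<sigma>) = (\<integral>x. km_poly q r (sqrt q * x) \<partial>measure_pmf (pmf_of_multiset ?M))"
    unfolding mu_col_def spec_measure_def by (subst integral_distr) auto
  also have "\<dots> = (\<Sum>x\<in>#?M. km_poly q r (sqrt q * x)) / real (N * nV G)"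
    using eigs_nonempty by (subst pmf_of_multiset_expectation) (auto simp: size_eigs)
  also have "(\<Sum>x\<in>#?M. km_poly q r (sqrt q * x)) = (\<Sum>z\<in>#eigs. km_poly q r (Re z))"
    using q by (simp add: image_mset.compositionality o_def)
  finally have "of_real (\<integral>x. km_poly q r (sqrt q * x) \<partial>mu_col q G N \<sigma>) =
    complex_of_real (\<Sum>z\<in>#eigs. km_poly q r (Re z)) / of_nat (N * nV G)" by simp
  also have "complex_of_real (\<Sum>z\<in>#eigs. km_poly q r (Re z)) = (\<Sum>z\<in>#eigs. km_poly q r z)"
  proof -
    have "complex_of_real (\<Sum>z\<in>#E. km_poly q r (Re z)) = (\<Sum>z\<in>#E. complex_of_real (km_poly q r (Re z)))" for E
      by (induction E) auto
    also have "(\<Sum>z\<in>#eigs. complex_of_real (km_poly q r (Re z))) = (\<Sum>z\<in>#eigs. km_poly q r z)"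
    proof (intro arg_cong[of _ _ sum_mset] image_mset_cong)
      fix z assume "z \<in># eigs"
      then have "complex_of_real (Re z) = z" using eigs_real_bounded(1) by (simp add: complex_eq_iff)
      then show "complex_of_real (km_poly q r (Re z)) = km_poly q r z" by (simp add: of_real_km_poly)
    qed
    finally show ?thesis .
  qed
  also have "\<dots> = (\<Sum>x<N * nV G. nbm G N \<sigma> r $$ (x, x))"
    by (rule trace_km_poly[OF col_adj_mat_carrier nbm_carrier nbm.simps(1) nbm_1 nbm_recurrence, symmetric])
  finally show ?thesis .
qed

lemma integral_km_poly_0_mu_col: "(\<integral>x. km_poly q 0 (sqrt q * x) \<partial>mu_col q G N \<sigma>) = 1"
proof -
  interpret real_distribution "mu_col q G N \<sigma>" by (rule real_distribution_mu_col)
  show ?thesis using prob_space by simp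
qed

text \<open>The factor \<open>N\<close> of the trace bound cancels against the normalization, so the
  bound depends on the graph alone.\<close>

lemma integral_km_poly_mu_col_dominated:
  assumes "q \<ge> 1"
  shows "\<bar>\<integral>x. km_poly q (Suc r) (sqrt q * x) \<partial>mu_col q G N \<sigma>\<bar> \<le> real (closed_nbt G r) / real (nV G)"
proof -
  have "\<bar>\<integral>x. km_poly q (Suc r) (sqrt q * x) \<partial>mu_col q G N \<sigma>\<bar>
      = cmod (of_real (\<integral>x. km_poly q (Suc r) (sqrt q * x) \<partial>mu_col q G N \<sigma>))"
    by (simp only: norm_of_real real_norm_def)
  also have "\<dots> = cmod (\<Sum>x<N * nV G. nbm G N \<sigma> (Suc r) $$ (x, x)) / real (N * nV G)"
    unfolding integral_km_poly_mu_col[OF assms] norm_divide norm_of_nat by simp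
  also have "\<dots> \<le> real N * real (closed_nbt G r) / real (N * nV G)"
    by (intro divide_right_mono trace_nbm_dominated) simp
  also have "\<dots> = real (closed_nbt G r) / real (nV G)" using N_pos by simp
  finally show ?thesis .
qed

lemma integral_km_poly_mu_col_trivial:
  assumes "q \<ge> 1" "\<And>e. e < nE G \<Longrightarrow> \<sigma> e = 1\<^sub>m N"
  shows "(\<integral>x. km_poly q (Suc r) (sqrt q * x) \<partial>mu_col q G N \<sigma>) = real (closed_nbt G r) / real (nV G)"
proof -
  have t: "(\<Sum>x<N * nV G. nbm G N \<sigma> (Suc r) $$ (x, x)) = of_nat N * of_nat (closed_nbt G r)"
    by (rule trace_nbm_trivial) (rule assms(2))
  have "complex_of_real (\<integral>x. km_poly q (Suc r) (sqrt q * x) \<partial>mu_col q G N \<sigma>)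
      = complex_of_real (real (closed_nbt G r) / real (nV G))"
    unfolding integral_km_poly_mu_col[OF assms(1)] t using N_pos by simp
  then show ?thesis by (simp only: of_real_eq_iff)
qed

end

lemma weak_conv_mu_col_iff:
  assumes q: "q \<ge> 1" and cg: "\<And>n. colored_graph (G n) q (N n) (\<sigma> n)"
  shows "weak_conv_m (\<lambda>n. mu_col q (G n) (N n) (\<sigma> n)) (kesten_mckay q) \<longleftrightarrow>
    (\<forall>r. (\<lambda>n. \<integral>x. km_poly q (Suc r) (sqrt q * x) \<partial>mu_col q (G n) (N n) (\<sigma> n)) \<longlonglongrightarrow> 0)"
proof -
  define B where "B = (real q + 1) / sqrt q"
  \<comment> \<open>One interval must carry the spectral measures and the limit: the scaled spectral
    radius bound \<open>B\<close> is at least the endpoint 2 of the Kesten--McKay support.\<close>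
  have "2 * sqrt q \<le> real q + 1"
    using zero_le_power2[of "sqrt q - 1"] by (simp add: power2_eq_square algebra_simps)
  then have B: "2 \<le> B" using q by (simp add: B_def field_simps)
  note rd = colored_graph.real_distribution_mu_col[OF cg] real_distribution_kesten_mckay[OF q]
  note ae = colored_graph.AE_mu_col[OF cg, folded B_def]
  have aek: "AE x in kesten_mckay q. \<bar>x\<bar> \<le> B"
    using AE_kesten_mckay by eventually_elim (use B in linarith)
  interpret K: real_distribution "kesten_mckay q" by (rule rd(2))
  have k0: "(\<integral>x. km_poly q 0 (sqrt q * x) \<partial>kesten_mckay q) = 1" using K.prob_space by simp
  have kS: "(\<integral>x. km_poly q (Suc r) (sqrt q * x) \<partial>kesten_mckay q) = 0" for r
    by (intro integral_km_poly_kesten_mckay q K.integrable_continuous_bounded_support[OF AE_kesten_mckay] continuous_intros)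
  have "weak_conv_m (\<lambda>n. mu_col q (G n) (N n) (\<sigma> n)) (kesten_mckay q) \<longleftrightarrow>
    (\<forall>r. (\<lambda>n. \<integral>x. km_poly q r (sqrt q * x) \<partial>mu_col q (G n) (N n) (\<sigma> n)) \<longlonglongrightarrow> (\<integral>x. km_poly q r (sqrt q * x) \<partial>kesten_mckay q))"
    by (rule weak_conv_iff_km_poly[OF q rd ae aek])
  also have "\<dots> \<longleftrightarrow> (\<forall>r. (\<lambda>n. \<integral>x. km_poly q (Suc r) (sqrt q * x) \<partial>mu_col q (G n) (N n) (\<sigma> n)) \<longlonglongrightarrow> 0)"
    (is "(\<forall>r. ?P r) \<longleftrightarrow> (\<forall>r. ?Q r)")
  proof -
    \<comment> \<open>Index 0 carries no information: both sides are total masses of probability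
      measures.\<close>
    have P0: "?P 0" unfolding k0 colored_graph.integral_km_poly_0_mu_col[OF cg] by (rule tendsto_const)
    have PS: "?P (Suc r) \<longleftrightarrow> ?Q r" for r unfolding kS ..
    show ?thesis
    proof (intro iffI allI)
      fix r assume "\<forall>r. ?P r"
      then show "?Q r" unfolding PS[symmetric] by blast
    next
      fix r assume "\<forall>r. ?Q r"
      then show "?P r" by (cases r) (simp_all only: P0 PS)
    qed
  qed
  finally show ?thesis .
qed

theorem theorem3p2:
  fixes q :: nat and G :: "nat \<Rightarrow> graph" and N :: "nat \<Rightarrow> nat"
    and Gs :: "nat \<Rightarrow> complex mat set"
  assumes "q \<ge> 1"
    and "\<And>n. regular_graph (q + 1) (G n)"
    and "\<And>n. N n \<ge> 1"
    and "\<And>n. subgroup_U (N n) (Gs n)"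
  shows "weak_conv_m (\<lambda>n. mu_graph q (G n)) (kesten_mckay q) \<longleftrightarrow>
         (\<forall>\<sigma> :: nat \<Rightarrow> nat \<Rightarrow> complex mat.
            (\<forall>n. is_color (G n) (N n) (Gs n) (\<sigma> n)) \<longrightarrow>
            weak_conv_m (\<lambda>n. mu_col q (G n) (N n) (\<sigma> n)) (kesten_mckay q))"
proof -
  have color: "colored_graph (G n) q (N n) (\<sigma> n)" if "is_color (G n) (N n) (Gs n) (\<sigma> n)" for n \<sigma>
    using assms(2)[of n] assms(3)[of n] assms(4)[of n] that
    by unfold_locales (auto simp: is_color_def subgroup_U_def)
  have trivial: "colored_graph (G n) q K (\<lambda>_. 1\<^sub>m K)" if "K \<ge> 1" for n K
    using assms(2)[of n] that by unfold_locales (auto simp: unitary_mat_one)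
  let ?c = "\<lambda>r n. real (closed_nbt (G n) r) / real (nV (G n))"
  \<comment> \<open>Applied with size 1 this concerns \<open>mu_graph\<close>, with size
    \<open>N n\<close> the trivial color; the criterion does not mention the size, so the two
    convergences are equivalent.\<close>
  have triv_iff: "weak_conv_m (\<lambda>n. mu_col q (G n) (K n) (\<lambda>_. 1\<^sub>m (K n))) (kesten_mckay q) \<longleftrightarrow> (\<forall>r. ?c r \<longlonglongrightarrow> 0)"
    if "\<And>n. K n \<ge> 1" for K
    unfolding weak_conv_mu_col_iff[OF assms(1) trivial[OF that]]
      colored_graph.integral_km_poly_mu_col_trivial[OF trivial[OF that] assms(1) refl] ..
  have base: "weak_conv_m (\<lambda>n. mu_graph q (G n)) (kesten_mckay q) \<longleftrightarrow> (\<forall>r. ?c r \<longlonglongrightarrow> 0)"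
    using triv_iff[of "\<lambda>_. 1"] by (simp add: mu_graph_def mu_col_def adj_mat_eq_col_adj_mat)
  show ?thesis
  proof (intro iffI allI impI)
    fix \<sigma> assume "weak_conv_m (\<lambda>n. mu_graph q (G n)) (kesten_mckay q)"
      and \<sigma>: "\<forall>n. is_color (G n) (N n) (Gs n) (\<sigma> n)"
    then have c0: "?c r \<longlonglongrightarrow> 0" for r using base by blast
    have cg: "colored_graph (G n) q (N n) (\<sigma> n)" for n using color \<sigma> by blast
    have "(\<lambda>n. \<integral>x. km_poly q (Suc r) (sqrt q * x) \<partial>mu_col q (G n) (N n) (\<sigma> n)) \<longlonglongrightarrow> 0" for r
      by (rule Lim_null_comparison[OF _ c0[of r]])
         (simp only: real_norm_def colored_graph.integral_km_poly_mu_col_dominated[OF cg assms(1)] eventually_True)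
    then show "weak_conv_m (\<lambda>n. mu_col q (G n) (N n) (\<sigma> n)) (kesten_mckay q)"
      unfolding weak_conv_mu_col_iff[OF assms(1) cg] by blast
  next
    assume *: "\<forall>\<sigma>. (\<forall>n. is_color (G n) (N n) (Gs n) (\<sigma> n)) \<longrightarrow>
      weak_conv_m (\<lambda>n. mu_col q (G n) (N n) (\<sigma> n)) (kesten_mckay q)"
    \<comment> \<open>The trivial color is admissible because the subgroup contains the
      identity.\<close>
    have "is_color (G n) (N n) (Gs n) (\<lambda>_. 1\<^sub>m (N n))" for n
      using assms(4)[of n] by (simp add: is_color_def subgroup_U_def)
    then have "weak_conv_m (\<lambda>n. mu_col q (G n) (N n) (\<lambda>_. 1\<^sub>m (N n))) (kesten_mckay q)"
      using *[rule_format, of "\<lambda>n _. 1\<^sub>m (N n)"] by blast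
    then show "weak_conv_m (\<lambda>n. mu_graph q (G n)) (kesten_mckay q)"
      using base triv_iff[of N] assms(3) by blast
  qed
qed

end
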